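(* Let $G$ be an abelian group and let $A_1$ be an ordered oriented flat virtual link invariant with values in $G$, extended linearly to a homomorphism $A_1:\mathcal{VL}_{\mathrm{flat}}\to G$. Let $\{(F_i,w_i,h_i,u_i)\}_{i\in\mathbb N}$ be a sequence such that, for every $i$, $F_i$ is an even weight function with values in $\mathcal{VL}_{\mathrm{flat}}$, $w_i$ is an even weight function with values in an abelian group $H_i$, $h_i\in H_i$, and $u_i$ is an odd weight function with values in $\mathbb Z$ (or with values in $G$, if $G$ is a ring) such that $R(u_i,D)\subset\{0\}$ for all link diagrams $D$. Define recursively $$A_{i+1}(D)=I_f\bigl(D;\,u_i*(A_i\circ F_i),\,w_i,\,h_i\bigr),\qquad i\ge 1 .$$ Then for every $i\ge1$: $A_i\circ F_i$ is an even weight function, $I\bigl(D;\,u_i*(A_i\circ F_i),\,w_i,\,h_i\bigr)$ is an ordered oriented virtual link invariant, and $A_{i+1}$ is an ordered oriented flat virtual link invariant (and hence extends linearly to a homomorphism $\mathcal{VL}_{\mathrm{flat}}\to G$).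
   Context: Diagrams. A virtual link diagram is a 4-regular plane diagram of immersed oriented circles in which every vertex is marked as a classical crossing (with over/under information) or as a virtual crossing. It is ordered if its $n$ components are labelled by $1,\dots,n$. Generalized Reidemeister moves are the classical moves RI, RII, RIII, the virtual moves VRI, VRII, VRIII, and the move SV, in which a strand having two virtual crossings with the two strands of a classical crossing is moved across that crossing (all orientations; labels respected). Ordered oriented virtual links are diagrams modulo these moves; ordered oriented flat virtual links are diagrams modulo these moves and crossing changes (switching over and under at a classical crossing). $\mathcal{VL}_{\mathrm{flat}}$ is the free $\mathbb Z$-module generated by ordered oriented flat virtual links. Weight functions. A function $w$ assigning to every classical crossing of every ordered oriented virtual link diagram an element of an abelian group $G$ is a weight function if: (C1) a crossing not involved in a generalized Reidemeister move has the same weight before and after the move; (C2) each of the three crossings involved in an RIII move has the same weight as the corresponding crossing after the move; (C3) the classical crossing involved in an SV move has the same weight before and after. It is odd (even) if the two crossings $\alpha,\beta$ involved in any RII move satisfy $w(\beta)=-w(\alpha)$ (respectively $w(\beta)=w(\alpha)$). Standing assumption: all weight functions are local with respect to crossing changes, i.e. a crossing change at $c_0$ does not alter the weight of any other crossing. The product is $(u*v)(c)=u(c)v(c)$ (for $u$ with values in $\mathbb Z$ and $v$ in $G$, or both in a ring $G$). $D^*$ is the diagram obtained from $D$ by changing all classical crossings, $c^*$ is the crossing of $D^*$ corresponding to $c$, and $w^*(c)=w(c^* )$. $R(w,D)$ is the set of values $w(c)$ over the crossings $c$ of $D$ that can be removed by a single RI move. I-functions: $I(D;v,w,g)=\sum_{c:\,w(c)=g}v(c)$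 and $I_f(D;v,w,g)=\sum_{c:\,w(c)=g}v(c)+\sum_{c:\,w^*(c)=g}v^*(c)$, sums over classical crossings $c$ of $D$. *)

theory Defs
  imports
    "HOL-Analysis.Analysis"
    "HOL-Algebra.Ring"
    "HOL-Algebra.Elementary_Groups"
    "HOL-Algebra.Free_Abelian_Groups"
begin

section \<open>Ordered oriented virtual link diagrams\<close>

text \<open>
  Diagrams are generic closed curves in the plane, in the topological category.  Component \<open>i\<close>
  (with \<open>1 \<le> i \<le> components D\<close>, its label) is the restriction of \<open>curve D i\<close> to the unit circle,
  oriented counterclockwise.  Vertices are the double points in the plane; \<open>virt D\<close> is the
  set of virtual ones, and \<open>over D\<close> consists of the preimages, on the overpassing strands, of
  the classical ones.
\<close>

record diagram =
  components :: nat
  curve :: "nat \<Rightarrow> complex \<Rightarrow> complex"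
  virt :: "complex set"
  over :: "(nat \<times> complex) set"

definition circles :: "diagram \<Rightarrow> (nat \<times> complex) set" where
  "circles D = {1..components D} \<times> sphere 0 1"

definition pt :: "diagram \<Rightarrow> nat \<times> complex \<Rightarrow> complex" where
  "pt D x = curve D (fst x) (snd x)"

definition preimages :: "diagram \<Rightarrow> complex \<Rightarrow> (nat \<times> complex) set" where
  "preimages D p = {x \<in> circles D. pt D x = p}"

definition double_points :: "diagram \<Rightarrow> complex set" where
  "double_points D = {p. \<exists>x\<in>preimages D p. \<exists>y\<in>preimages D p. x \<noteq> y}"

definition classical :: "diagram \<Rightarrow> complex set" where
  "classical D = double_points D - virt D"

definition plane_isotopy :: "(complex \<Rightarrow> complex) \<Rightarrow> bool" where
  "plane_isotopy h \<longleftrightarrow>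
     homotopic_with_canon (\<lambda>f. \<exists>g. homeomorphism UNIV UNIV f g) UNIV UNIV id h"

definition circle_isotopy :: "(complex \<Rightarrow> complex) \<Rightarrow> bool" where
  "circle_isotopy r \<longleftrightarrow>
     homotopic_with_canon (\<lambda>f. \<exists>g. homeomorphism (sphere 0 1) (sphere 0 1) f g)
       (sphere 0 1) (sphere 0 1) id r"

definition square :: "complex set" where
  "square = {z. \<bar>Re z\<bar> \<le> 1 \<and> \<bar>Im z\<bar> \<le> 1}"

text \<open>
  \<open>traces D h a ps\<close>: inside the disc \<open>h ` square\<close> the curves of \<open>D\<close> are exactly the images
  under \<open>h\<close> of the oriented plane arcs \<open>ps\<close>, each parametrized by \<open>{-1..1}\<close>.  The \<open>j\<close>-th of them
  is run through along the arc \<open>a j\<close> of one of the parameter circles.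
\<close>

definition traces ::
  "diagram \<Rightarrow> (complex \<Rightarrow> complex) \<Rightarrow> (nat \<Rightarrow> real \<Rightarrow> nat \<times> complex) \<Rightarrow>
   (real \<Rightarrow> complex) list \<Rightarrow> bool" where
  "traces D h a ps \<longleftrightarrow>
     (\<forall>j<length ps. \<exists>i\<in>{1..components D}. \<exists>\<theta>::real \<Rightarrow> real.
        continuous_on {-1..1} \<theta> \<and> strict_mono_on {-1..1} \<theta> \<and> \<theta> 1 < \<theta> (-1) + 2 * pi \<and>
        (\<forall>t\<in>{-1..1}. a j t = (i, cis (\<theta> t)))) \<and>
     inj_on (\<lambda>(j, t). a j t) ({..<length ps} \<times> {-1..1}) \<and>
     (\<forall>j<length ps. \<forall>t\<in>{-1..1}. pt D (a j t) = h ((ps ! j) t)) \<and>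
     {x \<in> circles D. pt D x \<in> h ` square} = (\<lambda>(j, t). a j t) ` ({..<length ps} \<times> {-1..1})"

text \<open>
  The local condition says that the circles are topologically immersed and that their
  only multiple points are transverse double points.
\<close>

definition is_diagram :: "diagram \<Rightarrow> bool" where
  "is_diagram D \<longleftrightarrow>
     1 \<le> components D \<and>
     (\<forall>i\<in>{1..components D}. continuous_on (sphere 0 1) (curve D i)) \<and>
     (\<forall>p\<in>pt D ` circles D. \<exists>h a. plane_isotopy h \<and> h 0 = p \<and>
        (traces D h a [\<lambda>t. Complex t 0] \<or>
         traces D h a [\<lambda>t. Complex t t, \<lambda>t. Complex t (- t)])) \<and>
     finite (double_points D) \<and>
     virt D \<subseteq> double_points D \<and>
     over D \<subseteq> (\<Union>c\<in>classical D. preimages D c) \<and>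
     (\<forall>c\<in>classical D. \<exists>!x. x \<in> preimages D c \<and> x \<in> over D)"

definition isotopic_by :: "(complex \<Rightarrow> complex) \<Rightarrow> diagram \<Rightarrow> diagram \<Rightarrow> bool" where
  "isotopic_by h D D' \<longleftrightarrow>
     is_diagram D \<and> is_diagram D' \<and> components D' = components D \<and> plane_isotopy h \<and>
     (\<exists>r. (\<forall>i\<in>{1..components D}. circle_isotopy (r i)) \<and>
          (\<forall>(i, z)\<in>circles D. pt D' (i, r i z) = h (pt D (i, z))) \<and>
          virt D' = h ` virt D \<and>
          over D' = (\<lambda>(i, z). (i, r i z)) ` over D)"

definition crossing_change :: "complex \<Rightarrow> diagram \<Rightarrow> diagram" where
  "crossing_change c D =
     D\<lparr>over := (over D - preimages D c) \<union> (preimages D c - over D)\<rparr>"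

text \<open>The diagram \<open>D\<^sup>*\<close>, whose crossings are the same points of the plane as those of \<open>D\<close>.\<close>

definition star_diagram :: "diagram \<Rightarrow> diagram" where
  "star_diagram D = D\<lparr>over := (\<Union>c\<in>classical D. preimages D c) - over D\<rparr>"


section \<open>Generalized Reidemeister moves\<close>

text \<open>
  A strand is an arc in \<open>square \<times> \<real>\<close>, parametrized by \<open>{-1..1}\<close>; its second component is a height.
  A tangle is a list of strands together with a set of points: a double point of the
  projection is virtual if it lies in this set; otherwise it is classical and the strand with
  the greater height passes over.
\<close>

type_synonym strand = "real \<Rightarrow> complex \<times> real"
type_synonym tangle = "strand list \<times> complex set"

definition projections :: "tangle \<Rightarrow> (real \<Rightarrow> complex) list" where
  "projections T = map (\<lambda>s t. fst (s t)) (fst T)"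

definition tangle_at ::
  "diagram \<Rightarrow> (complex \<Rightarrow> complex) \<Rightarrow> (nat \<Rightarrow> real \<Rightarrow> nat \<times> complex) \<Rightarrow> tangle \<Rightarrow> bool" where
  "tangle_at D h a T \<longleftrightarrow>
     traces D h a (projections T) \<and>
     (\<forall>z\<in>square. h z \<in> double_points D \<longrightarrow> (h z \<in> virt D \<longleftrightarrow> z \<in> snd T)) \<and>
     (\<forall>j<length (fst T). \<forall>k<length (fst T). \<forall>t\<in>{-1..1}. \<forall>s\<in>{-1..1}.
        (j, t) \<noteq> (k, s) \<and> fst ((fst T ! j) t) = fst ((fst T ! k) s) \<and>
        fst ((fst T ! j) t) \<notin> snd T \<longrightarrow>
        (a j t \<in> over D \<longleftrightarrow> snd ((fst T ! j) t) > snd ((fst T ! k) s)))"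

text \<open>Replacing the tangle \<open>T\<close> in \<open>D\<close>, in the disc \<open>h ` square\<close>, by \<open>T'\<close> gives \<open>D'\<close>.\<close>

definition replaces ::
  "(complex \<Rightarrow> complex) \<Rightarrow> tangle \<Rightarrow> tangle \<Rightarrow> diagram \<Rightarrow> diagram \<Rightarrow> bool" where
  "replaces h T T' D D' \<longleftrightarrow>
     is_diagram D \<and> is_diagram D' \<and> components D' = components D \<and> plane_isotopy h \<and>
     (\<exists>a. tangle_at D h a T \<and> tangle_at D' h a T') \<and>
     (\<forall>x\<in>circles D. pt D x \<notin> h ` square \<longrightarrow>
        pt D' x = pt D x \<and> (x \<in> over D' \<longleftrightarrow> x \<in> over D)) \<and>
     virt D' - h ` square = virt D - h ` square"

text \<open>The parameter \<open>e \<in> {1, -1}\<close> chooses the orientation of a strand.\<close>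

definition level :: "(real \<Rightarrow> complex) \<Rightarrow> real \<Rightarrow> real \<Rightarrow> strand" where
  "level p e k = (\<lambda>t. (p (e * t), k))"

text \<open>
  The curl has its only double point, \<open>\<i> / 4\<close>, at the parameters \<open>\<plusminus> 1 / sqrt 2\<close>; the sign of \<open>k\<close>
  decides which passage is the upper one.
\<close>

definition curl :: "real \<Rightarrow> real \<Rightarrow> strand" where
  "curl e k = (\<lambda>t. let s = e * t in (Complex (2 * s ^ 3 - s) ((1 - s\<^sup>2) / 2), k * s))"

definition pictures1 :: "complex set \<Rightarrow> (tangle \<times> tangle) set" where
  "pictures1 V =
     {(([level (\<lambda>t. Complex t 0) e 0], V), ([curl e k], V)) | e k.
        e \<in> {1, -1} \<and> k \<in> {1, -1}}"

definition pictures2 :: "complex set \<Rightarrow> (tangle \<times> tangle) set" where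
  "pictures2 V =
     {(([level (\<lambda>t. Complex t (- 1 / 2)) e1 k1, level (\<lambda>t. Complex t (1 / 2)) e2 k2], V),
       ([level (\<lambda>t. Complex t (1 / 2 - \<bar>t\<bar>)) e1 k1, level (\<lambda>t. Complex t (\<bar>t\<bar> - 1 / 2)) e2 k2], V))
      | e1 e2 k1 k2. {e1, e2} \<subseteq> {1, -1} \<and> k1 \<noteq> k2}"

text \<open>The third strand is moved across the crossing of the first two, which is at the origin.\<close>

definition pictures3 :: "complex set \<Rightarrow> (tangle \<times> tangle) set" where
  "pictures3 V =
     {(([level (\<lambda>t. Complex t t) e1 k1, level (\<lambda>t. Complex t (- t)) e2 k2,
         level (\<lambda>t. Complex t ((1 - \<bar>t\<bar>) / 2)) e3 k3], V),
       ([level (\<lambda>t. Complex t t) e1 k1, level (\<lambda>t. Complex t (- t)) e2 k2,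
         level (\<lambda>t. Complex t (- (1 - \<bar>t\<bar>) / 2)) e3 k3], V))
      | e1 e2 e3 k1 k2 k3. {e1, e2, e3} \<subseteq> {1, -1} \<and> distinct [k1, k2, k3]}"

datatype move = RI | RII | RIII | VRI | VRII | VRIII | SV

text \<open>
  Each move in one direction only; the inverse moves enter through the equivalence closure
  below.
\<close>

fun pictures :: "move \<Rightarrow> (tangle \<times> tangle) set" where
  "pictures RI = pictures1 {}"
| "pictures RII = pictures2 {}"
| "pictures RIII = pictures3 {}"
| "pictures VRI = pictures1 UNIV"
| "pictures VRII = pictures2 UNIV"
| "pictures VRIII = pictures3 UNIV"
| "pictures SV = pictures3 (- {0})"

definition move_in :: "move \<Rightarrow> (complex \<Rightarrow> complex) \<Rightarrow> diagram \<Rightarrow> diagram \<Rightarrow> bool" where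
  "move_in m h D D' \<longleftrightarrow> (\<exists>(T, T')\<in>pictures m. replaces h T T' D D')"

text \<open>\<open>z\<close> and \<open>z'\<close> are crossings of the same two strands in \<open>T\<close> and in \<open>T'\<close>, respectively.\<close>

definition corresponding :: "tangle \<Rightarrow> tangle \<Rightarrow> complex \<Rightarrow> complex \<Rightarrow> bool" where
  "corresponding T T' z z' \<longleftrightarrow>
     (\<exists>j k. j < k \<and> k < length (fst T) \<and> k < length (fst T') \<and>
        z \<in> (projections T ! j) ` {-1..1} \<inter> (projections T ! k) ` {-1..1} \<and>
        z' \<in> (projections T' ! j) ` {-1..1} \<inter> (projections T' ! k) ` {-1..1})"


section \<open>Virtual links and flat virtual links\<close>

definition virtual_step :: "diagram \<Rightarrow> diagram \<Rightarrow> bool" where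
  "virtual_step D D' \<longleftrightarrow> (\<exists>h. isotopic_by h D D') \<or> (\<exists>m h. move_in m h D D')"

definition flat_step :: "diagram \<Rightarrow> diagram \<Rightarrow> bool" where
  "flat_step D D' \<longleftrightarrow>
     virtual_step D D' \<or> (is_diagram D \<and> (\<exists>c\<in>classical D. D' = crossing_change c D))"

definition virtual_invariant :: "('g, 'r) ring_scheme \<Rightarrow> (diagram \<Rightarrow> 'g) \<Rightarrow> bool" where
  "virtual_invariant G f \<longleftrightarrow>
     (\<forall>D. is_diagram D \<longrightarrow> f D \<in> carrier G) \<and>
     (\<forall>D D'. is_diagram D \<and> is_diagram D' \<and> equivclp virtual_step D D' \<longrightarrow> f D = f D')"

definition flat_invariant :: "('g, 'r) ring_scheme \<Rightarrow> (diagram \<Rightarrow> 'g) \<Rightarrow> bool" where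
  "flat_invariant G f \<longleftrightarrow>
     (\<forall>D. is_diagram D \<longrightarrow> f D \<in> carrier G) \<and>
     (\<forall>D D'. is_diagram D \<and> is_diagram D' \<and> equivclp flat_step D D' \<longrightarrow> f D = f D')"

type_synonym flat_link = "diagram set"

definition flat_class :: "diagram \<Rightarrow> flat_link" where
  "flat_class D = {D'. is_diagram D' \<and> equivclp flat_step D D'}"

definition flat_links :: "flat_link set" where
  "flat_links = flat_class ` {D. is_diagram D}"

definition VL_flat :: "(flat_link \<Rightarrow>\<^sub>0 int) monoid" where
  "VL_flat = free_Abelian_group flat_links"

text \<open>
  The linear extension of a flat invariant to \<open>VL_flat\<close>; \<open>the_elem (f ` K)\<close> is the common value
  of \<open>f\<close> on the diagrams of the flat link \<open>K\<close>.
\<close>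

definition linear_extension ::
  "('g, 'r) ring_scheme \<Rightarrow> (diagram \<Rightarrow> 'g) \<Rightarrow> (flat_link \<Rightarrow>\<^sub>0 int) \<Rightarrow> 'g" where
  "linear_extension G f x =
     finsum G (\<lambda>K. add_pow G (Poly_Mapping.lookup x K) (the_elem (f ` K))) (Poly_Mapping.keys x)"


section \<open>Weight functions\<close>

text \<open>
  Values matter only at the classical crossings of diagrams.  The first two clauses
  express that the weights lie in the group and depend on the diagram up to plane isotopy and
  reparametrization.  Then come invariance for crossings not involved in a move (lying
  outside its disc), for the three crossings of an RIII move, for the classical crossing of an
  SV move, and locality with respect to crossing changes.
\<close>

type_synonym 'a weight = "diagram \<Rightarrow> complex \<Rightarrow> 'a"

definition weight_function :: "('a, 'm) monoid_scheme \<Rightarrow> 'a weight \<Rightarrow> bool" where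
  "weight_function M w \<longleftrightarrow>
     (\<forall>D. is_diagram D \<longrightarrow> (\<forall>c\<in>classical D. w D c \<in> carrier M)) \<and>
     (\<forall>h D D'. isotopic_by h D D' \<longrightarrow> (\<forall>c\<in>classical D. w D' (h c) = w D c)) \<and>
     (\<forall>m h D D'. move_in m h D D' \<longrightarrow>
        (\<forall>c\<in>classical D - h ` square. w D' c = w D c)) \<and>
     (\<forall>h D D'. \<forall>(T, T')\<in>pictures RIII. replaces h T T' D D' \<longrightarrow>
        (\<forall>z z'. corresponding T T' z z' \<longrightarrow> w D' (h z') = w D (h z))) \<and>
     (\<forall>h D D'. move_in SV h D D' \<longrightarrow> w D' (h 0) = w D (h 0)) \<and>
     (\<forall>D. is_diagram D \<longrightarrow> (\<forall>c0\<in>classical D. \<forall>c\<in>classical D - {c0}.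
        w (crossing_change c0 D) c = w D c))"

definition odd_weight :: "('a, 'm) monoid_scheme \<Rightarrow> 'a weight \<Rightarrow> bool" where
  "odd_weight M w \<longleftrightarrow> weight_function M w \<and>
     (\<forall>h D D'. move_in RII h D D' \<longrightarrow>
        (\<forall>\<alpha>\<in>classical D' \<inter> h ` square. \<forall>\<beta>\<in>classical D' \<inter> h ` square.
           \<alpha> \<noteq> \<beta> \<longrightarrow> w D' \<beta> = inv\<^bsub>M\<^esub> (w D' \<alpha>)))"

definition even_weight :: "('a, 'm) monoid_scheme \<Rightarrow> 'a weight \<Rightarrow> bool" where
  "even_weight M w \<longleftrightarrow> weight_function M w \<and>
     (\<forall>h D D'. move_in RII h D D' \<longrightarrow>
        (\<forall>\<alpha>\<in>classical D' \<inter> h ` square. \<forall>\<beta>\<in>classical D' \<inter> h ` square.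
           \<alpha> \<noteq> \<beta> \<longrightarrow> w D' \<beta> = w D' \<alpha>))"

definition star_weight :: "'a weight \<Rightarrow> 'a weight" where
  "star_weight w D c = w (star_diagram D) c"

definition R_set :: "'a weight \<Rightarrow> diagram \<Rightarrow> 'a set" where
  "R_set w D = {w D c | c. c \<in> classical D \<and> (\<exists>h D'. move_in RI h D' D \<and> c \<in> h ` square)}"

text \<open>Weights with values in the integers, or in \<open>G\<close> itself when \<open>G\<close> is a ring.\<close>

datatype 'g multiplier = Int_Valued "int weight" | Ring_Valued "'g weight"

fun odd_multiplier :: "('g, 'r) ring_scheme \<Rightarrow> 'g multiplier \<Rightarrow> bool" where
  "odd_multiplier G (Int_Valued u) \<longleftrightarrow>
     odd_weight integer_group u \<and> (\<forall>D. is_diagram D \<longrightarrow> R_set u D \<subseteq> {0})"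
| "odd_multiplier G (Ring_Valued u) \<longleftrightarrow>
     ring G \<and> odd_weight (add_monoid G) u \<and> (\<forall>D. is_diagram D \<longrightarrow> R_set u D \<subseteq> {\<zero>\<^bsub>G\<^esub>})"

fun weight_product :: "('g, 'r) ring_scheme \<Rightarrow> 'g multiplier \<Rightarrow> 'g weight \<Rightarrow> 'g weight" where
  "weight_product G (Int_Valued u) v = (\<lambda>D c. add_pow G (u D c) (v D c))"
| "weight_product G (Ring_Valued u) v = (\<lambda>D c. u D c \<otimes>\<^bsub>G\<^esub> v D c)"

text \<open>The functions \<open>I(D; v, w, g)\<close> and \<open>I\<^sub>f(D; v, w, g)\<close>.\<close>

definition I_fun ::
  "('g, 'r) ring_scheme \<Rightarrow> diagram \<Rightarrow> 'g weight \<Rightarrow> 'h weight \<Rightarrow> 'h \<Rightarrow> 'g" where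
  "I_fun G D v w g = finsum G (v D) {c \<in> classical D. w D c = g}"

definition I_flat ::
  "('g, 'r) ring_scheme \<Rightarrow> diagram \<Rightarrow> 'g weight \<Rightarrow> 'h weight \<Rightarrow> 'h \<Rightarrow> 'g" where
  "I_flat G D v w g =
     I_fun G D v w g \<oplus>\<^bsub>G\<^esub> I_fun G D (star_weight v) (star_weight w) g"

text \<open>The composite of the linear extension of a flat invariant with a \<open>VL_flat\<close>-valued weight.\<close>

definition compose_weight ::
  "('g, 'r) ring_scheme \<Rightarrow> (diagram \<Rightarrow> 'g) \<Rightarrow> (flat_link \<Rightarrow>\<^sub>0 int) weight \<Rightarrow> 'g weight" where
  "compose_weight G f F = (\<lambda>D c. linear_extension G f (F D c))"

end

theory Submission
  imports Defs
begin

text \<open>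
  Let \<open>p = u * (A \<circ> F)\<close>: it is an odd weight that vanishes at every crossing removable by RI.  The
  sum of \<open>p\<close> over the crossings with \<open>w = g\<close> is then a virtual link invariant, because an RI crossing
  contributes \<open>0\<close>, the two crossings of an RII move have equal \<open>w\<close> and opposite \<open>p\<close>, and all other moves
  match the crossings before and after with the same \<open>w\<close> and \<open>p\<close>.  Passing from \<open>D\<close> to \<open>D\<^sup>*\<close> turns moves
  into moves, so the flat sum is also invariant under the moves.  Changing one crossing \<open>c\<close> exchanges,
  by locality, the contributions of \<open>c\<close> in \<open>D\<close> and in \<open>D\<^sup>*\<close> and fixes all the others.
\<close>

section \<open>Isotopies and preimages of double points\<close>

text \<open>Locality says nothing about the changed crossing itself: both its value under
  \<open>p\<close> and the outcome of the test \<open>w = g\<close> are unconstrained. Hence the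
  one-sided sum is claimed only as a virtual invariant, and \<open>star_diagram D\<close> is brought
  in because it is reached from the diagram changed at \<open>c\<close> by changes away from
  \<open>c\<close>. The recursion closes up because flat invariance of \<open>A i\<close> is what
  allows its linear extension to be evaluated on flat classes, so that composing it with
  \<open>F i\<close> gives a weight again. That composite only has to be even: the sign that cancels
  an RII pair is supplied afresh by \<open>u i\<close> at every stage. The main obstacle is that
  moves are tangle replacements in topological discs. All questions about a disc are therefore
  transported to explicit arcs in \<open>square\<close>, where crossings can be computed, and the
  star is imitated there by negating heights.\<close>

lemma plane_isotopy_inj:
  assumes "plane_isotopy h"
  shows "inj h"
proof -
  have "\<exists>g. homeomorphism UNIV UNIV h g"
    using homotopic_with_imp_property[OF assms[unfolded plane_isotopy_def]] by (rule conjunct2)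
  then show ?thesis
    by (metis homeomorphism_apply1 injI iso_tuple_UNIV_I)
qed

lemma circle_isotopy_bij:
  assumes "circle_isotopy r"
  shows "bij_betw r (sphere 0 1) (sphere 0 1)"
proof -
  have "\<exists>g. homeomorphism (sphere 0 1) (sphere 0 1) r g"
    using homotopic_with_imp_property[OF assms[unfolded circle_isotopy_def]] by (rule conjunct2)
  then obtain g where "homeomorphism (sphere 0 1) (sphere 0 1) r g" ..
  then show ?thesis
    unfolding homeomorphism_def bij_betw_def by (metis inj_on_inverseI)
qed

lemma over_update [simp]:
  "components (D\<lparr>over := U\<rparr>) = components D"
  "circles (D\<lparr>over := U\<rparr>) = circles D"
  "pt (D\<lparr>over := U\<rparr>) = pt D"
  "preimages (D\<lparr>over := U\<rparr>) = preimages D"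
  "double_points (D\<lparr>over := U\<rparr>) = double_points D"
  "classical (D\<lparr>over := U\<rparr>) = classical D"
  "traces (D\<lparr>over := U\<rparr>) = traces D"
  by (auto simp: fun_eq_iff circles_def pt_def preimages_def double_points_def classical_def
      traces_def)

lemma over_subset:
  assumes "is_diagram D"
  shows "over D \<subseteq> (\<Union>c\<in>classical D. preimages D c)"
  using assms unfolding is_diagram_def by blast

lemma finite_classical:
  assumes "is_diagram D"
  shows "finite (classical D)"
  using assms unfolding is_diagram_def classical_def by blast

text \<open>In both local models of \<open>is_diagram\<close> a strand passes the origin only at
  parameter 0, so at most two circle points lie over \<open>h 0\<close>. For the one-strand model
  the element \<open>a 1 0\<close> merely enlarges the bound.\<close>

lemma traces_at_origin:
  assumes "traces D h a [\<lambda>t. Complex t 0] \<or>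
      traces D h a [\<lambda>t. Complex t t, \<lambda>t. Complex t (- t)]" (is "traces D h a ?p \<or> traces D h a ?q")
    and "inj h"
  shows "preimages D (h 0) \<subseteq> {a 0 0, a 1 0}"
proof
  fix x assume x: "x \<in> preimages D (h 0)"
  have "0 \<in> square" by (simp add: square_def)
  then have x': "x \<in> {x \<in> circles D. pt D x \<in> h ` square}" "pt D x = h 0"
    using x by (auto simp: preimages_def)
  obtain ps where ps: "traces D h a ps" "ps = ?p \<or> ps = ?q" using assms(1) by blast
  then obtain j t where jt: "j < length ps" "t \<in> {-1..1}" "x = a j t"
    using x'(1) unfolding traces_def by auto
  then have "h ((ps ! j) t) = h 0"
    using ps(1) x'(2) unfolding traces_def by metis
  then have "(ps ! j) t = 0" using assms(2) by (simp add: inj_eq)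
  moreover have "j = 0 \<or> j = 1" using jt(1) ps(2) by auto
  ultimately have "t = 0" using ps(2) jt(1) by (auto simp: complex_eq_iff)
  then show "x \<in> {a 0 0, a 1 0}" using jt \<open>j = 0 \<or> j = 1\<close> by auto
qed

text \<open>A double point has two distinct preimages by definition, and the local model rules out a
  third.\<close>

lemma preimages_double_point:
  assumes D: "is_diagram D" and p: "p \<in> double_points D"
  obtains x y where "x \<noteq> y" "preimages D p = {x, y}"
proof -
  obtain x y where xy: "x \<noteq> y" "x \<in> preimages D p" "y \<in> preimages D p"
    using p unfolding double_points_def by blast
  then have "p \<in> pt D ` circles D" by (auto simp: preimages_def)
  then obtain h a where "plane_isotopy h" "h 0 = p" "traces D h a [\<lambda>t. Complex t 0] \<or>
      traces D h a [\<lambda>t. Complex t t, \<lambda>t. Complex t (- t)]"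
    using D unfolding is_diagram_def by blast
  then have "preimages D p \<subseteq> {a 0 0, a 1 0}"
    using traces_at_origin plane_isotopy_inj by blast
  then have "preimages D p = {x, y}" using xy by blast
  then show thesis using that xy by blast
qed


section \<open>Crossing changes\<close>

text \<open>The symmetric difference of \<open>over D\<close> with the preimages of
  \<open>S\<close>. It interpolates between \<open>crossing_change\<close>, for a singleton, and
  \<open>star_diagram\<close>, for all classical crossings, so that locality can be
  iterated.\<close>

definition switch :: "complex set \<Rightarrow> diagram \<Rightarrow> diagram" where
  "switch S D = D\<lparr>over := (over D - (\<Union>c\<in>S. preimages D c)) \<union> ((\<Union>c\<in>S. preimages D c) - over D)\<rparr>"

lemma crossing_change_eq_switch: "crossing_change c D = switch {c} D"
  by (simp add: crossing_change_def switch_def)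

lemma star_diagram_eq_switch:
  assumes "is_diagram D"
  shows "star_diagram D = switch (classical D) D"
proof -
  have "over D - (\<Union>c\<in>classical D. preimages D c) = {}"
    using over_subset[OF assms] by blast
  then show ?thesis unfolding star_diagram_def switch_def by (simp only: Un_empty_left)
qed

lemma classical_switch [simp]: "classical (switch S D) = classical D"
  by (simp add: switch_def)

lemma classical_crossing_change [simp]: "classical (crossing_change c D) = classical D"
  by (simp add: crossing_change_def)

lemma classical_star [simp]: "classical (star_diagram D) = classical D"
  by (simp add: star_diagram_def)

text \<open>A crossing has exactly two preimages, so exactly one of them is over if and only if
  exactly one is under. Fibres over different points are disjoint, so crossings outside
  \<open>S\<close> are unaffected.\<close>

lemma is_diagram_switch:
  assumes D: "is_diagram D" and S: "S \<subseteq> classical D"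
  shows "is_diagram (switch S D)"
proof -
  let ?P = "\<Union>c\<in>S. preimages D c"
  let ?U = "(over D - ?P) \<union> (?P - over D)"
  have sub: "?U \<subseteq> (\<Union>c\<in>classical D. preimages D c)"
    using over_subset[OF D] S by blast
  have ex: "\<forall>c\<in>classical D. \<exists>!x. x \<in> preimages D c \<and> x \<in> ?U"
  proof
    fix c assume c: "c \<in> classical D"
    show "\<exists>!x. x \<in> preimages D c \<and> x \<in> ?U"
    proof (cases "c \<in> S")
      case True
      obtain x y where xy: "x \<noteq> y" "preimages D c = {x, y}"
        using preimages_double_point[OF D] c unfolding classical_def by blast
      have "\<exists>!x. x \<in> preimages D c \<and> x \<in> over D" using D c unfolding is_diagram_def by blast
      then have "\<exists>!z. z \<in> preimages D c \<and> z \<notin> over D" using xy by auto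
      moreover have "x \<in> ?U \<longleftrightarrow> x \<notin> over D" if "x \<in> preimages D c" for x
        using that True by blast
      ultimately show ?thesis by metis
    next
      case False
      then have "x \<in> ?U \<longleftrightarrow> x \<in> over D" if "x \<in> preimages D c" for x
        using that by (auto simp: preimages_def)
      moreover have "\<exists>!x. x \<in> preimages D c \<and> x \<in> over D" using D c unfolding is_diagram_def by blast
      ultimately show ?thesis by metis
    qed
  qed
  have "curve (D\<lparr>over := ?U\<rparr>) = curve D" "virt (D\<lparr>over := ?U\<rparr>) = virt D"
    "over (D\<lparr>over := ?U\<rparr>) = ?U"
    by simp_all
  note eqs = over_update this
  show ?thesis
    using D sub ex unfolding is_diagram_def switch_def eqs
    by (elim conjE) (intro conjI; assumption)
qed

lemma is_diagram_crossing_change: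
  assumes "is_diagram D" "c \<in> classical D"
  shows "is_diagram (crossing_change c D)"
  using assms is_diagram_switch by (simp add: crossing_change_eq_switch)

lemma is_diagram_star:
  assumes "is_diagram D"
  shows "is_diagram (star_diagram D)"
  using assms is_diagram_switch by (simp add: star_diagram_eq_switch)

lemma switch_insert:
  assumes "c \<notin> S"
  shows "switch (insert c S) D = crossing_change c (switch S D)"
proof -
  let ?P = "\<Union>c\<in>S. preimages D c"
  have "preimages D c \<inter> ?P = {}" using assms by (auto simp: preimages_def)
  then have "(over D - (preimages D c \<union> ?P)) \<union> ((preimages D c \<union> ?P) - over D) =
      ((over D - ?P) \<union> (?P - over D) - preimages D c) \<union>
      (preimages D c - ((over D - ?P) \<union> (?P - over D)))"
    by blast
  then show ?thesis unfolding switch_def crossing_change_def by simp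
qed

text \<open>Locality concerns one crossing change; finiteness of \<open>classical D\<close> lets it
  be iterated. The intermediate diagrams all have the same classical crossings, so \<open>c\<close>
  always remains a crossing other than the one being changed.\<close>

lemma weight_switch:
  assumes w: "weight_function M w" and D: "is_diagram D"
    and S: "S \<subseteq> classical D" and c: "c \<in> classical D - S"
  shows "w (switch S D) c = w D c"
proof -
  have "finite S" using S finite_classical[OF D] finite_subset by blast
  then show ?thesis using S c
  proof (induction S)
    case empty
    then show ?case by (simp add: switch_def)
  next
    case (insert x S)
    have "is_diagram (switch S D)" using insert.prems by (intro is_diagram_switch D) auto
    moreover have "x \<in> classical (switch S D)" "c \<in> classical (switch S D) - {x}"
      using insert.prems by auto
    ultimately have "w (crossing_change x (switch S D)) c = w (switch S D) c"
      using w unfolding weight_function_def by blast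
    also have "\<dots> = w D c" using insert by blast
    finally show ?case using insert.hyps by (simp add: switch_insert)
  qed
qed

text \<open>The two forms serve different crossings: the first avoids changing \<open>c\<close>,
  hence controls the weight at \<open>c\<close>; the second is a single change applied to the star,
  hence controls the weights elsewhere.\<close>

lemma star_crossing_change:
  assumes D: "is_diagram D" and c: "c \<in> classical D"
  shows "star_diagram (crossing_change c D) = switch (classical D - {c}) D"
    and "star_diagram (crossing_change c D) = crossing_change c (star_diagram D)"
proof -
  let ?C = "\<Union>c\<in>classical D. preimages D c"
  let ?P = "preimages D c"
  have C: "over D \<subseteq> ?C" "?P \<subseteq> ?C" using over_subset[OF D] c by auto
  have eq: "(\<Union>c\<in>classical D - {c}. preimages D c) = ?C - ?P"
    by (auto simp: preimages_def)
  have "?C - ((over D - ?P) \<union> (?P - over D)) =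
      (over D - (?C - ?P)) \<union> ((?C - ?P) - over D)"
    using C by blast
  then show "star_diagram (crossing_change c D) = switch (classical D - {c}) D"
    unfolding switch_def eq by (simp add: star_diagram_def crossing_change_def)
  have "?C - ((over D - ?P) \<union> (?P - over D)) = ((?C - over D) - ?P) \<union> (?P - (?C - over D))"
    using C by blast
  then show "star_diagram (crossing_change c D) = crossing_change c (star_diagram D)"
    by (simp add: star_diagram_def crossing_change_def)
qed

lemma crossing_change_involutive: "crossing_change c (crossing_change c D) = D"
proof -
  have "(((over D - P) \<union> (P - over D)) - P) \<union> (P - ((over D - P) \<union> (P - over D))) = over D" for P
    by blast
  then show ?thesis unfolding crossing_change_def by simp
qed

text \<open>\<open>D\<^sup>*\<close> arises from \<open>crossing_change c D\<close> by changing all crossings but \<open>c\<close>, so by locality the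
  weights of \<open>c\<close> in \<open>D\<close> and \<open>D\<^sup>*\<close> are swapped.\<close>

lemma weight_crossing_change:
  assumes w: "weight_function M w" and D: "is_diagram D" and c: "c \<in> classical D"
  shows "w (crossing_change c D) c = w (star_diagram D) c"
    and "w (star_diagram (crossing_change c D)) c = w D c"
    and "\<And>x. x \<in> classical D \<Longrightarrow> x \<noteq> c \<Longrightarrow> w (crossing_change c D) x = w D x"
    and "\<And>x. x \<in> classical D \<Longrightarrow> x \<noteq> c \<Longrightarrow>
      w (star_diagram (crossing_change c D)) x = w (star_diagram D) x"
proof -
  let ?D = "crossing_change c D"
  have star: "w (star_diagram (crossing_change c D)) c = w D c"
    if "is_diagram D" "c \<in> classical D" for D
    using that by (simp add: star_crossing_change(1) weight_switch[OF w])
  show "w (star_diagram ?D) c = w D c" using star D c .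
  \<comment> \<open>The previous claim is applied to the changed diagram; changing \<open>c\<close>
    twice restores \<open>D\<close>.\<close>
  have "w (star_diagram (crossing_change c ?D)) c = w ?D c"
    using star[of ?D] is_diagram_crossing_change[OF D c] c by simp
  then show "w ?D c = w (star_diagram D) c" by (simp add: crossing_change_involutive)
  have local: "w (crossing_change c D) x = w D x"
    if "is_diagram D" "c \<in> classical D" "x \<in> classical D" "x \<noteq> c" for x D
    using w that unfolding weight_function_def by blast
  show "w ?D x = w D x" if "x \<in> classical D" "x \<noteq> c" for x
    using local D c that .
  show "w (star_diagram ?D) x = w (star_diagram D) x" if "x \<in> classical D" "x \<noteq> c" for x
    using local[of "star_diagram D" x] is_diagram_star[OF D] c that
    by (simp add: star_crossing_change(2)[OF D c])
qed

section \<open>Crossings inside the disc of a move\<close>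

text \<open>Coincidences are taken between different pairs of strand and parameter, not between
  different strands, because the curl of RI crosses itself.\<close>

definition tangle_crossings :: "tangle \<Rightarrow> complex set" where
  "tangle_crossings T = {z. z \<notin> snd T \<and> (\<exists>j k t s. j < length (fst T) \<and> k < length (fst T) \<and>
     t \<in> {-1..1} \<and> s \<in> {-1..1} \<and> (j, t) \<noteq> (k, s) \<and>
     fst ((fst T ! j) t) = z \<and> fst ((fst T ! k) s) = z)}"

text \<open>\<open>tangle_at\<close> decides overpassing by a strict inequality, and negating
  heights complements that decision only if no crossing has equal heights.\<close>

definition generic_heights :: "tangle \<Rightarrow> bool" where
  "generic_heights T \<longleftrightarrow> (\<forall>j k t s. j < length (fst T) \<and> k < length (fst T) \<and>
     t \<in> {-1..1} \<and> s \<in> {-1..1} \<and> (j, t) \<noteq> (k, s) \<and>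
     fst ((fst T ! j) t) = fst ((fst T ! k) s) \<and> fst ((fst T ! j) t) \<notin> snd T \<longrightarrow>
     snd ((fst T ! j) t) \<noteq> snd ((fst T ! k) s))"

text \<open>The counterpart of \<open>star_diagram\<close> for tangles.\<close>

definition mirror_tangle :: "tangle \<Rightarrow> tangle" where
  "mirror_tangle T = (map (\<lambda>s t. (fst (s t), - snd (s t))) (fst T), snd T)"

lemma projections_mirror [simp]: "projections (mirror_tangle T) = projections T"
  by (simp add: projections_def mirror_tangle_def)

lemma traces_arc:
  assumes tr: "traces D h a (projections T)" and "inj h" and "j < length (fst T)" "t \<in> {-1..1}"
  shows "pt D (a j t) = h (fst ((fst T ! j) t))" "a j t \<in> circles D" "fst ((fst T ! j) t) \<in> square"
proof -
  show 1: "pt D (a j t) = h (fst ((fst T ! j) t))"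
    using assms unfolding traces_def projections_def by simp
  have "(j, t) \<in> {..<length (projections T)} \<times> {-1..1}"
    using assms by (simp add: projections_def)
  then have "a j t \<in> (\<lambda>(j, t). a j t) ` ({..<length (projections T)} \<times> {-1..1})"
    by force
  then have 2: "a j t \<in> {x \<in> circles D. pt D x \<in> h ` square}"
    using tr unfolding traces_def by simp
  then show "a j t \<in> circles D" by simp
  show "fst ((fst T ! j) t) \<in> square"
    using 1 2 assms(2) by (auto dest: injD)
qed

lemma traces_inj:
  assumes "traces D h a (projections T)" "j < length (fst T)" "t \<in> {-1..1}"
    "k < length (fst T)" "s \<in> {-1..1}" "(j, t) \<noteq> (k, s)"
  shows "a j t \<noteq> a k s"
proof
  assume "a j t = a k s"
  then have "(\<lambda>(j, t). a j t) (j, t) = (\<lambda>(j, t). a j t) (k, s)" by simp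
  moreover have "inj_on (\<lambda>(j, t). a j t) ({..<length (projections T)} \<times> {-1..1})"
    using assms(1) unfolding traces_def by blast
  moreover have "(j, t) \<in> {..<length (projections T)} \<times> {-1..1}"
    "(k, s) \<in> {..<length (projections T)} \<times> {-1..1}"
    using assms by (simp_all add: projections_def)
  ultimately show False
    using assms(6) inj_onD[of "\<lambda>(j, t). a j t" _ "(j, t)" "(k, s)"] by blast
qed

lemma traces_preimage:
  assumes tr: "traces D h a (projections T)" and h: "inj h" and "z \<in> square"
    and "x \<in> preimages D (h z)"
  obtains j t where "j < length (fst T)" "t \<in> {-1..1}" "x = a j t" "fst ((fst T ! j) t) = z"
proof -
  have "x \<in> {x \<in> circles D. pt D x \<in> h ` square}"
    using assms by (auto simp: preimages_def)
  then have "x \<in> (\<lambda>(j, t). a j t) ` ({..<length (projections T)} \<times> {-1..1})"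
    using tr unfolding traces_def by simp
  then obtain j t where jt: "j < length (fst T)" "t \<in> {-1..1}" "x = a j t"
    by (auto simp: projections_def)
  then have "h (fst ((fst T ! j) t)) = h z"
    using traces_arc(1)[OF tr h jt(1,2)] assms(4) by (simp add: preimages_def)
  then show thesis using that jt h by (simp add: inj_eq)
qed

text \<open>\<open>traces\<close> puts the circle points over the disc in bijection with the strand
  parameters, and \<open>h\<close> is injective, so double points in the disc are coincidences of
  model parameters; \<open>tangle_at\<close> matches the virtual marks. All later counting in a disc
  takes place in the model.\<close>

lemma classical_in_disc:
  assumes T: "tangle_at D h a T" and h: "inj h"
  shows "classical D \<inter> h ` square = h ` tangle_crossings T"
proof (intro equalityI subsetI)
  have tr: "traces D h a (projections T)" using T unfolding tangle_at_def by blast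
  have virt: "h z \<in> virt D \<longleftrightarrow> z \<in> snd T" if "z \<in> square" "h z \<in> double_points D" for z
    using T that unfolding tangle_at_def by blast
  {
    fix p assume "p \<in> classical D \<inter> h ` square"
    then obtain z where z: "p = h z" "z \<in> square" "h z \<in> double_points D" "h z \<notin> virt D"
      unfolding classical_def by blast
    then obtain x y where xy: "x \<noteq> y" "x \<in> preimages D (h z)" "y \<in> preimages D (h z)"
      unfolding double_points_def by blast
    obtain j t where jt: "j < length (fst T)" "t \<in> {-1..1}" "x = a j t" "fst ((fst T ! j) t) = z"
      using traces_preimage[OF tr h z(2) xy(2)] .
    obtain k s where ks: "k < length (fst T)" "s \<in> {-1..1}" "y = a k s" "fst ((fst T ! k) s) = z"
      using traces_preimage[OF tr h z(2) xy(3)] .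
    have "z \<in> tangle_crossings T"
      using jt ks xy(1) z virt unfolding tangle_crossings_def by blast
    then show "p \<in> h ` tangle_crossings T" using z by blast
  next
    fix p assume "p \<in> h ` tangle_crossings T"
    then obtain z j k t s where z: "p = h z" "z \<notin> snd T" and
      jt: "j < length (fst T)" "t \<in> {-1..1}" "fst ((fst T ! j) t) = z" and
      ks: "k < length (fst T)" "s \<in> {-1..1}" "fst ((fst T ! k) s) = z" and ne: "(j, t) \<noteq> (k, s)"
      unfolding tangle_crossings_def by blast
    have sq: "z \<in> square" using traces_arc(3)[OF tr h jt(1,2)] jt by simp
    have "a j t \<in> preimages D p" "a k s \<in> preimages D p"
      using traces_arc(1,2)[OF tr h jt(1,2)] traces_arc(1,2)[OF tr h ks(1,2)] jt ks z
      by (simp_all add: preimages_def)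
    then have "p \<in> double_points D"
      using traces_inj[OF tr jt(1,2) ks(1,2) ne] unfolding double_points_def by blast
    then show "p \<in> classical D \<inter> h ` square"
      using virt sq z unfolding classical_def by blast
  }
qed

text \<open>At a classical crossing the star complements membership in \<open>over\<close>, which
  for generic heights amounts to reversing the height comparison.\<close>

lemma tangle_at_star:
  assumes D: "is_diagram D" and T: "tangle_at D h a T" and h: "inj h" and gen: "generic_heights T"
  shows "tangle_at (star_diagram D) h a (mirror_tangle T)"
proof -
  have tr: "traces D h a (projections T)" using T unfolding tangle_at_def by blast
  have "a j t \<in> over (star_diagram D) \<longleftrightarrow> snd ((fst T ! j) t) < snd ((fst T ! k) s)"
    if jk: "j < length (fst T)" "k < length (fst T)" and ts: "t \<in> {-1..1}" "s \<in> {-1..1}" and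
      ne: "(j, t) \<noteq> (k, s)" and eq: "fst ((fst T ! j) t) = fst ((fst T ! k) s)" and
      V: "fst ((fst T ! j) t) \<notin> snd T" for j k t s
  proof -
    let ?z = "fst ((fst T ! j) t)"
    have "?z \<in> tangle_crossings T"
      using jk ts ne eq V unfolding tangle_crossings_def by fastforce
    then have "h ?z \<in> classical D" using classical_in_disc[OF T h] by blast
    moreover have "a j t \<in> preimages D (h ?z)"
      using traces_arc(1,2)[OF tr h jk(1) ts(1)] by (simp add: preimages_def)
    ultimately have "a j t \<in> over (star_diagram D) \<longleftrightarrow> a j t \<notin> over D"
      by (auto simp: star_diagram_def)
    moreover have "a j t \<in> over D \<longleftrightarrow> snd ((fst T ! j) t) > snd ((fst T ! k) s)"
      using T jk ts ne eq V unfolding tangle_at_def by blast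
    moreover have "snd ((fst T ! j) t) \<noteq> snd ((fst T ! k) s)"
      using gen jk ts ne eq V unfolding generic_heights_def by blast
    ultimately show ?thesis by linarith
  qed
  note over = this
  have "\<forall>z\<in>square. h z \<in> double_points D \<longrightarrow> (h z \<in> virt D \<longleftrightarrow> z \<in> snd T)"
    using T unfolding tangle_at_def by blast
  moreover have "virt (star_diagram D) = virt D" "double_points (star_diagram D) = double_points D"
    "traces (star_diagram D) = traces D"
    by (simp_all add: star_diagram_def)
  moreover have "fst ((fst (mirror_tangle T) ! j) t) = fst ((fst T ! j) t)"
    "snd ((fst (mirror_tangle T) ! j) t) = - snd ((fst T ! j) t)" if "j < length (fst T)" for j t
    using that by (simp_all add: mirror_tangle_def)
  moreover have "length (fst (mirror_tangle T)) = length (fst T)" "snd (mirror_tangle T) = snd T"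
    by (simp_all add: mirror_tangle_def)
  ultimately show ?thesis
    using tr unfolding tangle_at_def projections_mirror
    by (intro conjI allI impI ballI) (simp_all only: neg_less_iff_less simp_thms, metis over)
qed

section \<open>Replacing a tangle: what stays fixed outside the disc\<close>

lemma replaces_circles:
  assumes "replaces h T T' D D'"
  shows "circles D' = circles D"
  using assms unfolding replaces_def circles_def by simp

text \<open>\<open>replaces\<close> uses one family of arcs \<open>a\<close> for both diagrams, so
  with equally many strands the same circle points lie over the disc before and after.\<close>

lemma replaces_in_disc:
  assumes R: "replaces h T T' D D'" and len: "length (fst T') = length (fst T)"
    and x: "x \<in> circles D"
  shows "pt D' x \<in> h ` square \<longleftrightarrow> pt D x \<in> h ` square"
proof -
  obtain a where a: "tangle_at D h a T" "tangle_at D' h a T'"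
    using R unfolding replaces_def by blast
  have in_disc: "{x \<in> circles E. pt E x \<in> h ` square} =
      (\<lambda>(j, t). a j t) ` ({..<length (fst S)} \<times> {-1..1})" if "tangle_at E h a S" for E S
    using that unfolding tangle_at_def traces_def projections_def by (elim conjE) simp
  have "{x \<in> circles D'. pt D' x \<in> h ` square} = {x \<in> circles D. pt D x \<in> h ` square}"
    unfolding in_disc[OF a(1)] in_disc[OF a(2)] len ..
  then show ?thesis using x replaces_circles[OF R] by blast
qed

lemma replaces_preimages:
  assumes R: "replaces h T T' D D'" and len: "length (fst T') = length (fst T)"
    and p: "p \<notin> h ` square"
  shows "preimages D' p = preimages D p"
proof -
  have "x \<in> preimages D' p \<longleftrightarrow> x \<in> preimages D p" for x
  proof (cases "x \<in> circles D \<and> pt D x \<notin> h ` square")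
    case True
    then have "pt D' x = pt D x" using R unfolding replaces_def by blast
    then show ?thesis using replaces_circles[OF R] by (simp add: preimages_def)
  next
    case False
    then have "x \<in> circles D \<Longrightarrow> pt D x \<noteq> p \<and> pt D' x \<noteq> p"
      using replaces_in_disc[OF R len] p by metis
    then show ?thesis using replaces_circles[OF R] by (auto simp: preimages_def)
  qed
  then show ?thesis by blast
qed

lemma replaces_classical:
  assumes R: "replaces h T T' D D'" and len: "length (fst T') = length (fst T)"
  shows "classical D' - h ` square = classical D - h ` square"
proof -
  have "p \<in> double_points D' \<longleftrightarrow> p \<in> double_points D" if "p \<notin> h ` square" for p
    using replaces_preimages[OF R len that] by (simp add: double_points_def)
  moreover have "virt D' - h ` square = virt D - h ` square"
    using R unfolding replaces_def by blast
  ultimately show ?thesis unfolding classical_def by blast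
qed

lemma over_star:
  "x \<in> over (star_diagram D) \<longleftrightarrow> x \<in> circles D \<and> pt D x \<in> classical D \<and> x \<notin> over D"
  by (auto simp: star_diagram_def preimages_def)

lemma star_simps [simp]:
  "components (star_diagram D) = components D"
  "circles (star_diagram D) = circles D"
  "pt (star_diagram D) = pt D"
  "preimages (star_diagram D) = preimages D"
  "virt (star_diagram D) = virt D"
  by (simp_all add: star_diagram_def)

text \<open>Inside the disc the same arcs trace the mirrored tangles; outside, \<open>over\<close>
  is complemented at the same crossings in both diagrams.\<close>

lemma replaces_star:
  assumes R: "replaces h T T' D D'" and len: "length (fst T') = length (fst T)"
    and gen: "generic_heights T" "generic_heights T'"
  shows "replaces h (mirror_tangle T) (mirror_tangle T') (star_diagram D) (star_diagram D')"
proof -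
  have D: "is_diagram D" "is_diagram D'" "components D' = components D" and h: "plane_isotopy h"
    and out: "\<And>x. x \<in> circles D \<Longrightarrow> pt D x \<notin> h ` square \<Longrightarrow>
        pt D' x = pt D x \<and> (x \<in> over D' \<longleftrightarrow> x \<in> over D)"
    and virt: "virt D' - h ` square = virt D - h ` square"
    using R unfolding replaces_def by blast+
  obtain a where "tangle_at D h a T" "tangle_at D' h a T'"
    using R unfolding replaces_def by blast
  then have "tangle_at (star_diagram D) h a (mirror_tangle T)"
    "tangle_at (star_diagram D') h a (mirror_tangle T')"
    using tangle_at_star D gen plane_isotopy_inj[OF h] by blast+
  moreover have "x \<in> over (star_diagram D') \<longleftrightarrow> x \<in> over (star_diagram D)"
    if "x \<in> circles D" "pt D x \<notin> h ` square" for x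
    using out[OF that] that replaces_classical[OF R len] replaces_circles[OF R]
    by (auto simp: over_star)
  ultimately show ?thesis
    using D h out virt unfolding replaces_def by (auto simp: is_diagram_star)
qed

section \<open>The pictures of the moves\<close>

lemma mirror_level [simp]: "(\<lambda>t. (fst (level p e k t), - snd (level p e k t))) = level p e (- k)"
  by (simp add: level_def)

lemma mirror_curl [simp]: "(\<lambda>t. (fst (curl e k t), - snd (curl e k t))) = curl e (- k)"
  by (simp add: curl_def Let_def)

text \<open>Each family is closed under negating heights: the curl admits both signs of
  \<open>k\<close>, the straight strand of RI has height 0, and distinct heights stay distinct. Thus
  the star of a move is a move of the same kind.\<close>

lemma mirror_pictures:
  assumes "(T, T') \<in> pictures m"
  shows "(mirror_tangle T, mirror_tangle T') \<in> pictures m"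
proof -
  have 1: "(mirror_tangle T, mirror_tangle T') \<in> pictures1 V" if TT: "(T, T') \<in> pictures1 V" for V
  proof -
    obtain e k where ek: "e \<in> {1, -1}" "k \<in> {1, -1}"
      "T = ([level (\<lambda>t. Complex t 0) e 0], V)" "T' = ([curl e k], V)"
      using TT unfolding pictures1_def by blast
    have "mirror_tangle T = T" "mirror_tangle T' = ([curl e (- k)], V)"
      using ek(3,4) by (simp_all add: mirror_tangle_def)
    moreover have "- k \<in> {1, -1}" using ek(2) by auto
    ultimately show ?thesis using ek unfolding pictures1_def by blast
  qed
  have 2: "(mirror_tangle T, mirror_tangle T') \<in> pictures2 V" if TT: "(T, T') \<in> pictures2 V" for V
  proof -
    obtain e1 e2 k1 k2 where ek: "{e1, e2} \<subseteq> {1, -1}" "k1 \<noteq> k2" and T: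
      "T = ([level (\<lambda>t. Complex t (- 1 / 2)) e1 k1, level (\<lambda>t. Complex t (1 / 2)) e2 k2], V)"
      "T' = ([level (\<lambda>t. Complex t (1 / 2 - \<bar>t\<bar>)) e1 k1, level (\<lambda>t. Complex t (\<bar>t\<bar> - 1 / 2)) e2 k2], V)"
      using TT unfolding pictures2_def by blast
    have "mirror_tangle T =
        ([level (\<lambda>t. Complex t (- 1 / 2)) e1 (- k1), level (\<lambda>t. Complex t (1 / 2)) e2 (- k2)], V)"
      "mirror_tangle T' = ([level (\<lambda>t. Complex t (1 / 2 - \<bar>t\<bar>)) e1 (- k1),
        level (\<lambda>t. Complex t (\<bar>t\<bar> - 1 / 2)) e2 (- k2)], V)"
      using T by (simp_all add: mirror_tangle_def)
    moreover have "- k1 \<noteq> - k2" using ek(2) by simp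
    ultimately show ?thesis using ek(1) unfolding pictures2_def by blast
  qed
  have 3: "(mirror_tangle T, mirror_tangle T') \<in> pictures3 V" if TT: "(T, T') \<in> pictures3 V" for V
  proof -
    obtain e1 e2 e3 k1 k2 k3 where ek: "{e1, e2, e3} \<subseteq> {1, -1}" "distinct [k1, k2, k3]" and T:
      "T = ([level (\<lambda>t. Complex t t) e1 k1, level (\<lambda>t. Complex t (- t)) e2 k2,
         level (\<lambda>t. Complex t ((1 - \<bar>t\<bar>) / 2)) e3 k3], V)"
      "T' = ([level (\<lambda>t. Complex t t) e1 k1, level (\<lambda>t. Complex t (- t)) e2 k2,
         level (\<lambda>t. Complex t (- (1 - \<bar>t\<bar>) / 2)) e3 k3], V)"
      using TT unfolding pictures3_def by blast
    have "mirror_tangle T =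
      ([level (\<lambda>t. Complex t t) e1 (- k1), level (\<lambda>t. Complex t (- t)) e2 (- k2),
         level (\<lambda>t. Complex t ((1 - \<bar>t\<bar>) / 2)) e3 (- k3)], V)"
      "mirror_tangle T' =
      ([level (\<lambda>t. Complex t t) e1 (- k1), level (\<lambda>t. Complex t (- t)) e2 (- k2),
         level (\<lambda>t. Complex t (- (1 - \<bar>t\<bar>) / 2)) e3 (- k3)], V)"
      using T by (simp_all add: mirror_tangle_def)
    moreover have "distinct [- k1, - k2, - k3]" using ek(2) by simp
    ultimately show ?thesis using ek(1) unfolding pictures3_def by blast
  qed
  show ?thesis using assms 1 2 3 by (cases m) simp_all
qed

text \<open>The strands of the moves other than RI are graphs over the real axis of constant height.\<close>

definition graph_strand :: "strand \<Rightarrow> real \<Rightarrow> bool" where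
  "graph_strand s k \<longleftrightarrow> (\<exists>f. \<exists>e\<in>{1, -1}. s = level (\<lambda>t. Complex t (f t)) e k)"

lemma graph_strand_level: "e \<in> {1, -1} \<Longrightarrow> graph_strand (level (\<lambda>t. Complex t (f t)) e k) k"
  unfolding graph_strand_def by blast

text \<open>The real part of the projection is \<open>e * t\<close>, so a graph strand never crosses
  itself.\<close>

lemma graph_strand_inj:
  assumes "graph_strand p k" "fst (p t) = fst (p s)"
  shows "t = s"
  using assms by (auto simp: graph_strand_def level_def)

lemma graph_strand_height:
  assumes "graph_strand p k"
  shows "snd (p t) = k"
  using assms by (auto simp: graph_strand_def level_def)

lemma graph_strands_crossing:
  assumes ks: "list_all2 graph_strand ps ks" and j: "j < length ps" and ne: "(j, t) \<noteq> (l, s)"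
    and eq: "fst ((ps ! j) t) = fst ((ps ! l) s)"
  shows "j \<noteq> l"
proof
  assume "j = l"
  moreover have "graph_strand (ps ! j) (ks ! j)" using ks j by (simp add: list_all2_nthD)
  ultimately have "t = s" using eq graph_strand_inj[of "ps ! j"] by blast
  then show False using ne \<open>j = l\<close> by simp
qed

text \<open>Since no strand crosses itself, a crossing belongs to two strands, whose constant
  heights are different entries of \<open>ks\<close>.\<close>

lemma graph_strands_generic:
  assumes ks: "list_all2 graph_strand (fst T) ks" and dist: "distinct ks"
  shows "generic_heights T"
  unfolding generic_heights_def
proof (intro allI impI, elim conjE)
  fix j l t s
  assume jl: "j < length (fst T)" "l < length (fst T)" and ne: "(j, t) \<noteq> (l, s)"
    and eq: "fst ((fst T ! j) t) = fst ((fst T ! l) s)"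
  have "j \<noteq> l" using graph_strands_crossing[OF ks jl(1) ne eq] .
  then have "ks ! j \<noteq> ks ! l"
    using dist jl list_all2_lengthD[OF ks] by (simp add: nth_eq_iff_index_eq)
  moreover have "snd ((fst T ! i) x) = ks ! i" if "i < length (fst T)" for i x
    by (rule graph_strand_height[OF list_all2_nthD[OF ks that]])
  ultimately show "snd ((fst T ! j) t) \<noteq> snd ((fst T ! l) s)" using jl by simp
qed

lemma pictures2_graphs:
  assumes "(T, T') \<in> pictures2 V"
  obtains ks where "length ks = 2" "distinct ks"
    "list_all2 graph_strand (fst T) ks" "list_all2 graph_strand (fst T') ks"
proof -
  obtain e1 e2 k1 k2 where ek: "{e1, e2} \<subseteq> {1, -1}" "k1 \<noteq> k2" and T:
    "T = ([level (\<lambda>t. Complex t (- 1 / 2)) e1 k1, level (\<lambda>t. Complex t (1 / 2)) e2 k2], V)"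
    "T' = ([level (\<lambda>t. Complex t (1 / 2 - \<bar>t\<bar>)) e1 k1, level (\<lambda>t. Complex t (\<bar>t\<bar> - 1 / 2)) e2 k2], V)"
    using assms unfolding pictures2_def by blast
  have e: "e1 \<in> {1, -1}" "e2 \<in> {1, -1}" using ek by auto
  show thesis
  proof (rule that)
    show "length [k1, k2] = 2" by simp
    show "distinct [k1, k2]" using ek(2) by simp
    show "list_all2 graph_strand (fst T) [k1, k2]" "list_all2 graph_strand (fst T') [k1, k2]"
      unfolding T fst_conv by (intro list.rel_intros graph_strand_level e)+
  qed
qed

lemma pictures3_graphs:
  assumes "(T, T') \<in> pictures3 V"
  obtains ks where "length ks = 3" "distinct ks"
    "list_all2 graph_strand (fst T) ks" "list_all2 graph_strand (fst T') ks"
proof -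
  obtain e1 e2 e3 k1 k2 k3 where ek: "{e1, e2, e3} \<subseteq> {1, -1}" "distinct [k1, k2, k3]" and T:
    "T = ([level (\<lambda>t. Complex t t) e1 k1, level (\<lambda>t. Complex t (- t)) e2 k2,
       level (\<lambda>t. Complex t ((1 - \<bar>t\<bar>) / 2)) e3 k3], V)"
    "T' = ([level (\<lambda>t. Complex t t) e1 k1, level (\<lambda>t. Complex t (- t)) e2 k2,
       level (\<lambda>t. Complex t (- (1 - \<bar>t\<bar>) / 2)) e3 k3], V)"
    using assms unfolding pictures3_def by blast
  have e: "e1 \<in> {1, -1}" "e2 \<in> {1, -1}" "e3 \<in> {1, -1}" using ek by auto
  show thesis
  proof (rule that)
    show "length [k1, k2, k3] = 3" by simp
    show "distinct [k1, k2, k3]" using ek(2) by simp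
    show "list_all2 graph_strand (fst T) [k1, k2, k3]" "list_all2 graph_strand (fst T') [k1, k2, k3]"
      unfolding T fst_conv by (intro list.rel_intros graph_strand_level e)+
  qed
qed

lemma pictures1_generic:
  assumes "(T, T') \<in> pictures1 V"
  shows "length (fst T') = length (fst T)" "generic_heights T" "generic_heights T'"
proof -
  obtain e k where ek: "e \<in> {1, -1}" "k \<in> {1, -1}"
    "T = ([level (\<lambda>t. Complex t 0) e 0], V)" "T' = ([curl e k], V)"
    using assms unfolding pictures1_def by blast
  show "length (fst T') = length (fst T)" using ek by simp
  show "generic_heights T"
    using graph_strands_generic[of T "[0]"] graph_strand_level[of e "\<lambda>t. 0" 0] ek(1,3) by simp
  \<comment> \<open>The height \<open>k * e * t\<close> of the curl is injective in
    \<open>t\<close>, so the double point need not be located.\<close>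
  show "generic_heights T'"
    using ek(1,2,4) by (auto simp: generic_heights_def curl_def Let_def)
qed

lemma pictures_generic:
  assumes "(T, T') \<in> pictures m"
  shows "length (fst T') = length (fst T)" "generic_heights T" "generic_heights T'"
proof -
  have 2: "length (fst T') = length (fst T) \<and> generic_heights T \<and> generic_heights T'"
    if "(T, T') \<in> pictures2 V" for V
    using pictures2_graphs[OF that] graph_strands_generic list_all2_lengthD by metis
  have 3: "length (fst T') = length (fst T) \<and> generic_heights T \<and> generic_heights T'"
    if "(T, T') \<in> pictures3 V" for V
    using pictures3_graphs[OF that] graph_strands_generic list_all2_lengthD by metis
  have "length (fst T') = length (fst T) \<and> generic_heights T \<and> generic_heights T'"
    using assms 2 3 pictures1_generic by (cases m) simp_all
  then show "length (fst T') = length (fst T)" "generic_heights T" "generic_heights T'" by simp_all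
qed

text \<open>The two sides of a three-strand move differ by the half turn about the origin: it
  reverses the two diagonals and takes the upper bent strand to the lower one. This one symmetry
  provides the matching of crossings for both RIII and SV.\<close>

lemma pictures3_reflection:
  assumes "(T, T') \<in> pictures3 V" "j < 3"
  shows "fst ((fst T' ! j) (- t)) = - fst ((fst T ! j) t)"
proof -
  obtain e1 e2 e3 k1 k2 k3 where T:
    "T = ([level (\<lambda>t. Complex t t) e1 k1, level (\<lambda>t. Complex t (- t)) e2 k2,
       level (\<lambda>t. Complex t ((1 - \<bar>t\<bar>) / 2)) e3 k3], V)"
    "T' = ([level (\<lambda>t. Complex t t) e1 k1, level (\<lambda>t. Complex t (- t)) e2 k2,
       level (\<lambda>t. Complex t (- (1 - \<bar>t\<bar>) / 2)) e3 k3], V)"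
    using assms(1) unfolding pictures3_def by blast
  have "j = 0 \<or> j = 1 \<or> j = 2" using assms(2) by linarith
  then show ?thesis unfolding T by (elim disjE) (simp_all add: level_def complex_eq_iff field_simps)
qed

lemma pictures3_shape:
  assumes "(T, T') \<in> pictures3 V"
  shows "length (fst T) = 3" "length (fst T') = 3" "snd T = V" "snd T' = V"
  using assms unfolding pictures3_def by auto

lemma pictures3_crossing_strands:
  assumes P: "(T, T') \<in> pictures3 V" and z: "z \<in> tangle_crossings T"
  obtains j k t s where "j < k" "k < 3" "t \<in> {-1..1}" "s \<in> {-1..1}"
    "fst ((fst T ! j) t) = z" "fst ((fst T ! k) s) = z"
proof -
  obtain j k t s where *: "j < 3" "k < 3" "t \<in> {-1..1}" "s \<in> {-1..1}" "(j, t) \<noteq> (k, s)"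
    "fst ((fst T ! j) t) = z" "fst ((fst T ! k) s) = z"
    using z pictures3_shape[OF P] unfolding tangle_crossings_def by auto
  obtain ks where "list_all2 graph_strand (fst T) ks" using pictures3_graphs[OF P] by blast
  then have "j \<noteq> k"
    using graph_strands_crossing[of "fst T" ks j t k s] * pictures3_shape[OF P] by simp
  then consider "j < k" | "k < j" by linarith
  then show thesis using that * by cases blast+
qed

text \<open>The RIII clause of \<open>weight_function\<close> is phrased through pairs of strands;
  the half turn keeps each strand index, so \<open>z\<close> and \<open>- z\<close> lie on the same
  pair.\<close>

lemma pictures3_corresponding:
  assumes P: "(T, T') \<in> pictures3 V" and z: "z \<in> tangle_crossings T"
  shows "corresponding T T' z (- z)"
proof -
  obtain j k t s where *: "j < k" "k < 3" "t \<in> {-1..1}" "s \<in> {-1..1}"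
    "fst ((fst T ! j) t) = z" "fst ((fst T ! k) s) = z"
    using pictures3_crossing_strands[OF P z] .
  have refl: "fst ((fst T' ! j) (- t)) = - z" "fst ((fst T' ! k) (- s)) = - z"
    using pictures3_reflection[OF P] * by simp_all
  have mem: "y \<in> (projections U ! i) ` {-1..1}"
    if "fst ((fst U ! i) x) = y" "x \<in> {-1..1}" "i < length (fst U)" for U i x y
    using that by (auto simp: projections_def)
  have len: "j < length (fst T)" "k < length (fst T)" "j < length (fst T')" "k < length (fst T')"
    using *(1,2) pictures3_shape[OF P] by linarith+
  have "- t \<in> {-1..1}" "- s \<in> {-1..1}" using *(3,4) by auto
  then have "z \<in> (projections T ! j) ` {-1..1}" "z \<in> (projections T ! k) ` {-1..1}"
    "- z \<in> (projections T' ! j) ` {-1..1}" "- z \<in> (projections T' ! k) ` {-1..1}"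
    using mem[OF *(5,3) len(1)] mem[OF *(6,4) len(2)] mem[OF refl(1) _ len(3)]
      mem[OF refl(2) _ len(4)] by blast+
  then show ?thesis
    unfolding corresponding_def using *(1) len(2,4) by blast
qed

text \<open>The half turn preserves crossings as soon as it preserves the virtual marks;
  \<open>V\<close> will be \<open>{}\<close> for RIII and \<open>- {0}\<close> for SV.\<close>

lemma pictures3_crossings:
  assumes P: "(T, T') \<in> pictures3 V" and V: "\<And>z. - z \<in> V \<longleftrightarrow> z \<in> V"
  shows "tangle_crossings T' = uminus ` tangle_crossings T"
proof -
  have refl: "fst ((fst T ! j) (- t)) = - fst ((fst T' ! j) t)" if "j < 3" for j t
    using pictures3_reflection[OF P that, of "- t"] by simp
  \<comment> \<open>Abstract tangles are used because the half turn is its own inverse, so the same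
    argument gives both inclusions.\<close>
  have imp: "- z \<in> tangle_crossings U'"
    if z: "z \<in> tangle_crossings U" and U: "length (fst U) = 3" "length (fst U') = 3" "snd U = V" "snd U' = V"
      and r: "\<And>j t. j < 3 \<Longrightarrow> fst ((fst U' ! j) (- t)) = - fst ((fst U ! j) t)" for z U U'
  proof -
    obtain j k t s where *: "j < 3" "k < 3" "t \<in> {-1..1}" "s \<in> {-1..1}" "(j, t) \<noteq> (k, s)"
      "fst ((fst U ! j) t) = z" "fst ((fst U ! k) s) = z" and "z \<notin> V"
      using z U unfolding tangle_crossings_def by auto
    have "fst ((fst U' ! j) (- t)) = - z" "fst ((fst U' ! k) (- s)) = - z"
      using r * by simp_all
    moreover have "- t \<in> {-1..1}" "- s \<in> {-1..1}" "(j, - t) \<noteq> (k, - s)" using * by auto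
    moreover have "- z \<notin> V" using V \<open>z \<notin> V\<close> by simp
    ultimately show ?thesis
      using *(1,2) U unfolding tangle_crossings_def by (simp only: mem_Collect_eq) blast
  qed
  show ?thesis
  proof (intro equalityI subsetI)
    fix z assume "z \<in> tangle_crossings T'"
    then have "- z \<in> tangle_crossings T"
      using imp[of z T' T] pictures3_shape[OF P] refl by blast
    then show "z \<in> uminus ` tangle_crossings T" by (metis image_eqI minus_minus)
  next
    fix z assume "z \<in> uminus ` tangle_crossings T"
    then show "z \<in> tangle_crossings T'"
      using imp[of _ T T'] pictures3_shape[OF P] pictures3_reflection[OF P] by blast
  qed
qed

lemma pictures2_crossings:
  assumes P: "(T, T') \<in> pictures2 {}"
  shows "tangle_crossings T = {}" "tangle_crossings T' = {Complex (1 / 2) 0, Complex (- 1 / 2) 0}"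
proof -
  obtain e1 e2 k1 k2 where ek: "{e1, e2} \<subseteq> {1, -1}" and T:
    "T = ([level (\<lambda>t. Complex t (- 1 / 2)) e1 k1, level (\<lambda>t. Complex t (1 / 2)) e2 k2], {})"
    "T' = ([level (\<lambda>t. Complex t (1 / 2 - \<bar>t\<bar>)) e1 k1, level (\<lambda>t. Complex t (\<bar>t\<bar> - 1 / 2)) e2 k2], {})"
    using P unfolding pictures2_def by blast
  have e: "e1 \<in> {1, -1}" "e2 \<in> {1, -1}" using ek by simp_all
  obtain ks where ks: "list_all2 graph_strand (fst T) ks" "list_all2 graph_strand (fst T') ks"
    using pictures2_graphs[OF P] by blast
  have strands: "\<exists>t s. fst ((fst U ! 0) t) = z \<and> fst ((fst U ! 1) s) = z"
    if z: "z \<in> tangle_crossings U" and U: "list_all2 graph_strand (fst U) ks" "length (fst U) = 2"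
    for U z
  proof -
    obtain j k t s where *: "j < 2" "k < 2" "(j, t) \<noteq> (k, s)"
      "fst ((fst U ! j) t) = z" "fst ((fst U ! k) s) = z"
      using z U(2) unfolding tangle_crossings_def by auto
    have "j \<noteq> k" using graph_strands_crossing[OF U(1), of j t k s] * U(2) by simp
    then consider "j = 0" "k = 1" | "j = 1" "k = 0" using *(1,2) by linarith
    then show ?thesis using * by cases blast+
  qed
  show "tangle_crossings T = {}"
    using strands[of _ T, OF _ ks(1)] T(1) by (fastforce simp: level_def)
  show "tangle_crossings T' = {Complex (1 / 2) 0, Complex (- 1 / 2) 0}"
  proof (intro equalityI subsetI)
    fix z assume "z \<in> tangle_crossings T'"
    then obtain t s where "fst ((fst T' ! 0) t) = z" "fst ((fst T' ! 1) s) = z"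
      using strands[of z T', OF _ ks(2)] T(2) by auto
    \<comment> \<open>The strands are graphs of opposite functions, so they can meet only on the
      real axis.\<close>
    then have "Im z = 1 / 2 - \<bar>Re z\<bar>" "Im z = \<bar>Re z\<bar> - 1 / 2"
      using T(2) by (auto simp: level_def)
    then have "Im z = 0" "Re z = 1 / 2 \<or> Re z = - 1 / 2" by linarith+
    then show "z \<in> {Complex (1 / 2) 0, Complex (- 1 / 2) 0}" by (auto simp: complex_eq_iff)
  next
    fix z :: complex assume z: "z \<in> {Complex (1 / 2) 0, Complex (- 1 / 2) 0}"
    then have z': "Im z = 0" "\<bar>Re z\<bar> = 1 / 2" by auto
    \<comment> \<open>\<open>level\<close> multiplies the parameter by the orientation sign, whose
      square is 1; hence these parameters.\<close>
    have "fst ((fst T' ! 0) (e1 * Re z)) = z" "fst ((fst T' ! 1) (e2 * Re z)) = z"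
      using T(2) e z' by (auto simp: level_def complex_eq_iff)
    moreover have "e1 * Re z \<in> {-1..1}" "e2 * Re z \<in> {-1..1}" using e z' by auto
    moreover have "0 < length (fst T')" "1 < length (fst T')" "z \<notin> snd T'" using T(2) by auto
    moreover have "(0, e1 * Re z) \<noteq> (1 :: nat, e2 * Re z)" by simp
    ultimately show "z \<in> tangle_crossings T'" unfolding tangle_crossings_def by blast
  qed
qed

section \<open>Moves and isotopies of starred diagrams\<close>

lemma move_in_star:
  assumes "move_in m h D D'"
  shows "move_in m h (star_diagram D) (star_diagram D')"
proof -
  obtain T T' where T: "(T, T') \<in> pictures m" "replaces h T T' D D'"
    using assms unfolding move_in_def by blast
  then have "replaces h (mirror_tangle T) (mirror_tangle T') (star_diagram D) (star_diagram D')"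
    using replaces_star pictures_generic by blast
  then show ?thesis using mirror_pictures[OF T(1)] unfolding move_in_def by blast
qed

text \<open>Each \<open>r i\<close> is a bijection of the circle, so the reparametrization is a
  bijection of all parameter circles. It carries the fibre over \<open>p\<close> into the fibre over
  \<open>h p\<close>, and injectivity of \<open>h\<close> shows that nothing else lies
  there.\<close>

lemma isotopic_by_preimages:
  assumes iso: "isotopic_by h D D'"
  obtains r where "\<forall>i\<in>{1..components D}. circle_isotopy (r i)"
    "\<forall>(i, z)\<in>circles D. pt D' (i, r i z) = h (pt D (i, z))"
    "over D' = (\<lambda>(i, z). (i, r i z)) ` over D"
    "bij_betw (\<lambda>(i, z). (i, r i z)) (circles D) (circles D')"
    "\<forall>p. preimages D' (h p) = (\<lambda>(i, z). (i, r i z)) ` preimages D p"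
proof -
  have D: "components D' = components D" and h: "inj h"
    using iso plane_isotopy_inj unfolding isotopic_by_def by blast+
  obtain r where r: "\<forall>i\<in>{1..components D}. circle_isotopy (r i)"
    "\<forall>(i, z)\<in>circles D. pt D' (i, r i z) = h (pt D (i, z))"
    "over D' = (\<lambda>(i, z). (i, r i z)) ` over D"
    using iso unfolding isotopic_by_def by blast
  let ?\<phi> = "\<lambda>(i, z). (i, r i z)"
  have r': "inj_on (r i) (sphere 0 1)" "r i ` sphere 0 1 = sphere 0 1"
    if "i \<in> {1..components D}" for i
    using circle_isotopy_bij r(1) that unfolding bij_betw_def by blast+
  have bij: "bij_betw ?\<phi> (circles D) (circles D')"
    unfolding bij_betw_def
  proof
    show "inj_on ?\<phi> (circles D)"
    proof (rule inj_onI)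
      fix x y assume xy: "x \<in> circles D" "y \<in> circles D" "?\<phi> x = ?\<phi> y"
      obtain i z j w where "x = (i, z)" "y = (j, w)" by (cases x, cases y)
      then show "x = y" using xy inj_onD[OF r'(1)] unfolding circles_def by auto
    qed
    show "?\<phi> ` circles D = circles D'"
    proof (intro equalityI subsetI)
      fix x assume "x \<in> ?\<phi> ` circles D"
      then obtain i z where x: "i \<in> {1..components D}" "z \<in> sphere 0 1" "x = (i, r i z)"
        unfolding circles_def by auto
      have "r i z \<in> sphere 0 1" using imageI[OF x(2), of "r i"] r'(2)[OF x(1)] by (simp only:)
      then show "x \<in> circles D'" using x D unfolding circles_def by (simp only: mem_Sigma_iff)
    next
      fix x assume "x \<in> circles D'"
      then obtain i z where x: "x = (i, z)" "i \<in> {1..components D}" "z \<in> sphere 0 1"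
        using D unfolding circles_def by auto
      then have "z \<in> r i ` sphere 0 1" using r'(2)[OF x(2)] by (simp only:)
      then obtain y where "z = r i y" "y \<in> sphere 0 1" by (rule imageE)
      then have "x = ?\<phi> (i, y)" "(i, y) \<in> circles D" using x unfolding circles_def by auto
      then show "x \<in> ?\<phi> ` circles D" by blast
    qed
  qed
  have pt: "pt D' (?\<phi> x) = h (pt D x)" if "x \<in> circles D" for x
    using r(2) that by (cases x) auto
  have pre: "preimages D' (h p) = ?\<phi> ` preimages D p" for p
  proof (intro equalityI subsetI)
    fix x assume x: "x \<in> preimages D' (h p)"
    then have "x \<in> ?\<phi> ` circles D" using bij unfolding bij_betw_def preimages_def by blast
    then obtain y where y: "y \<in> circles D" "x = ?\<phi> y" by blast
    then have "pt D y = p" using pt x h by (simp add: preimages_def inj_eq)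
    then show "x \<in> ?\<phi> ` preimages D p" using y by (auto simp: preimages_def)
  next
    fix x assume "x \<in> ?\<phi> ` preimages D p"
    then obtain y where y: "y \<in> circles D" "pt D y = p" "x = ?\<phi> y"
      unfolding preimages_def by blast
    then have "x \<in> circles D'" using bij unfolding bij_betw_def by blast
    then show "x \<in> preimages D' (h p)" using pt y by (simp add: preimages_def)
  qed
  show thesis by (rule that[OF r bij]) (use pre in blast)
qed

lemma isotopic_by_classical:
  assumes iso: "isotopic_by h D D'"
  shows "classical D' = h ` classical D"
proof -
  have h: "inj h" and virt: "virt D' = h ` virt D"
    using iso plane_isotopy_inj unfolding isotopic_by_def by blast+
  obtain r where "\<forall>i\<in>{1..components D}. circle_isotopy (r i)"
    and pt: "\<forall>(i, z)\<in>circles D. pt D' (i, r i z) = h (pt D (i, z))"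
    and "over D' = (\<lambda>(i, z). (i, r i z)) ` over D"
    and bij': "bij_betw (\<lambda>(i, z). (i, r i z)) (circles D) (circles D')"
    and pre': "\<forall>p. preimages D' (h p) = (\<lambda>(i, z). (i, r i z)) ` preimages D p"
    using isotopic_by_preimages[OF iso] .
  define \<phi> where "\<phi> = (\<lambda>(i, z). (i, r i z))"
  have pre: "preimages D' (h p) = \<phi> ` preimages D p" for p
    using pre' unfolding \<phi>_def by (rule spec)
  have bij: "bij_betw \<phi> (circles D) (circles D')"
    using bij' unfolding \<phi>_def .
  have "h p \<in> double_points D' \<longleftrightarrow> p \<in> double_points D" for p
  proof
    assume "h p \<in> double_points D'"
    then obtain x y where "x \<in> preimages D p" "y \<in> preimages D p" "\<phi> x \<noteq> \<phi> y"
      unfolding double_points_def mem_Collect_eq pre by blast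
    moreover from this(3) have "x \<noteq> y" by (rule contrapos_nn) simp
    ultimately show "p \<in> double_points D" unfolding double_points_def by (intro CollectI bexI)
  next
    assume "p \<in> double_points D"
    then obtain x y where xy: "x \<in> preimages D p" "y \<in> preimages D p" "x \<noteq> y"
      unfolding double_points_def by blast
    then have "\<phi> x \<noteq> \<phi> y"
      using inj_onD[OF bij_betw_imp_inj_on[OF bij], of x y] unfolding preimages_def by blast
    then show "h p \<in> double_points D'"
      using xy unfolding double_points_def mem_Collect_eq pre
      by (intro bexI[of _ "\<phi> x"] bexI[of _ "\<phi> y"] imageI) simp_all
  qed
  \<comment> \<open>Surjectivity onto \<open>circles D'\<close> puts the whole curve of
    \<open>D'\<close> into the image of \<open>h\<close>.\<close>
  moreover have "p \<in> range h" if p: "p \<in> double_points D'" for p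
  proof -
    obtain x where x: "x \<in> circles D'" "pt D' x = p"
      using p unfolding double_points_def preimages_def by blast
    then have "x \<in> \<phi> ` circles D" using bij_betw_imp_surj_on[OF bij] by simp
    then obtain y where "x = \<phi> y" "y \<in> circles D" by (rule imageE)
    then have "p = h (pt D y)" using pt x unfolding \<phi>_def by (cases y) auto
    then show ?thesis by (rule range_eqI)
  qed
  ultimately have "double_points D' = h ` double_points D" by blast
  then show ?thesis unfolding classical_def virt using h by (simp add: image_set_diff)
qed

lemma isotopic_by_star:
  assumes iso: "isotopic_by h D D'"
  shows "isotopic_by h (star_diagram D) (star_diagram D')"
proof -
  have D: "is_diagram D" "is_diagram D'" "components D' = components D" "plane_isotopy h"
    "virt D' = h ` virt D"
    using iso unfolding isotopic_by_def by blast+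
  obtain r where r: "\<forall>i\<in>{1..components D}. circle_isotopy (r i)"
    "\<forall>(i, z)\<in>circles D. pt D' (i, r i z) = h (pt D (i, z))"
    and over': "over D' = (\<lambda>(i, z). (i, r i z)) ` over D"
    and bij': "bij_betw (\<lambda>(i, z). (i, r i z)) (circles D) (circles D')"
    and pre': "\<forall>p. preimages D' (h p) = (\<lambda>(i, z). (i, r i z)) ` preimages D p"
    using isotopic_by_preimages[OF iso] .
  define \<phi> where "\<phi> = (\<lambda>(i, z). (i, r i z))"
  have pre: "preimages D' (h p) = \<phi> ` preimages D p" for p
    using pre' unfolding \<phi>_def by (rule spec)
  have bij: "bij_betw \<phi> (circles D) (circles D')"
    using bij' unfolding \<phi>_def .
  have over: "over D' = \<phi> ` over D" using over' unfolding \<phi>_def .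
  let ?C = "\<Union>c\<in>classical D. preimages D c"
  have C: "?C \<subseteq> circles D" by (auto simp: preimages_def)
  then have O: "over D \<subseteq> circles D" using over_subset[OF D(1)] by blast
  have "(\<Union>c\<in>classical D'. preimages D' c) = \<phi> ` ?C"
    unfolding isotopic_by_classical[OF iso] using pre by auto
  then have "over (star_diagram D') = \<phi> ` ?C - \<phi> ` over D"
    by (simp add: star_diagram_def over)
  \<comment> \<open>Image and difference commute because \<phi> is injective on
    \<open>circles D\<close>, which contains both sets.\<close>
  also have "\<dots> = \<phi> ` (?C - over D)"
    using inj_on_image_set_diff[OF bij_betw_imp_inj_on[OF bij], of ?C "over D"] C O by blast
  also have "\<dots> = \<phi> ` over (star_diagram D)" by (simp add: star_diagram_def)
  finally have "over (star_diagram D') = \<phi> ` over (star_diagram D)" .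
  then show ?thesis
    unfolding isotopic_by_def star_simps
    using D r unfolding \<phi>_def by (intro conjI is_diagram_star exI[of _ r]) simp_all
qed

lemma virtual_step_star:
  assumes "virtual_step D D'"
  shows "virtual_step (star_diagram D) (star_diagram D')"
  using assms isotopic_by_star move_in_star unfolding virtual_step_def by blast

lemma virtual_step_diagrams:
  assumes "virtual_step D D'"
  shows "is_diagram D" "is_diagram D'"
  using assms
  unfolding virtual_step_def isotopic_by_def move_in_def replaces_def by blast+

section \<open>Weights under moves\<close>

lemma weight_functionI:
  assumes "\<And>D c. is_diagram D \<Longrightarrow> c \<in> classical D \<Longrightarrow> w D c \<in> carrier M"
    and "\<And>h D D' c. isotopic_by h D D' \<Longrightarrow> c \<in> classical D \<Longrightarrow> w D' (h c) = w D c"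
    and "\<And>m h D D' c. move_in m h D D' \<Longrightarrow> c \<in> classical D - h ` square \<Longrightarrow> w D' c = w D c"
    and "\<And>h T T' D D' z z'. (T, T') \<in> pictures RIII \<Longrightarrow> replaces h T T' D D' \<Longrightarrow>
      corresponding T T' z z' \<Longrightarrow> w D' (h z') = w D (h z)"
    and "\<And>h D D'. move_in SV h D D' \<Longrightarrow> w D' (h 0) = w D (h 0)"
    and "\<And>D c0 c. is_diagram D \<Longrightarrow> c0 \<in> classical D \<Longrightarrow> c \<in> classical D - {c0} \<Longrightarrow>
      w (crossing_change c0 D) c = w D c"
  shows "weight_function M w"
  unfolding weight_function_def
proof (intro conjI allI impI ballI)
  fix h D D' and TT :: "tangle \<times> tangle"
  assume TT: "TT \<in> pictures RIII"
  show "case TT of (T, T') \<Rightarrow> replaces h T T' D D' \<longrightarrow>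
      (\<forall>z z'. corresponding T T' z z' \<longrightarrow> w D' (h z') = w D (h z))"
    using TT assms(4) by (cases TT) simp
qed (rule assms; assumption)+

lemma
  assumes w: "weight_function M w"
  shows weight_carrier: "is_diagram D \<Longrightarrow> c \<in> classical D \<Longrightarrow> w D c \<in> carrier M"
    and weight_isotopy: "isotopic_by h D D' \<Longrightarrow> c \<in> classical D \<Longrightarrow> w D' (h c) = w D c"
    and weight_outside: "move_in m h D D' \<Longrightarrow> c \<in> classical D - h ` square \<Longrightarrow> w D' c = w D c"
    and weight_SV: "move_in SV h D D' \<Longrightarrow> w D' (h 0) = w D (h 0)"
    and weight_local: "is_diagram D \<Longrightarrow> c0 \<in> classical D \<Longrightarrow> c \<in> classical D - {c0} \<Longrightarrow>
      w (crossing_change c0 D) c = w D c"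
  using w unfolding weight_function_def by simp_all

lemma weight_RIII:
  assumes "weight_function M w" and TT: "(T, T') \<in> pictures RIII" "replaces h T T' D D'"
    "corresponding T T' z z'"
  shows "w D' (h z') = w D (h z)"
proof -
  have "\<forall>h D D'. \<forall>(T, T')\<in>pictures RIII. replaces h T T' D D' \<longrightarrow>
      (\<forall>z z'. corresponding T T' z z' \<longrightarrow> w D' (h z') = w D (h z))"
    using assms(1) unfolding weight_function_def by (elim conjE)
  from this[THEN spec[where x = h], THEN spec[where x = D], THEN spec[where x = D'],
      THEN bspec, OF TT(1)]
  show ?thesis using TT(2,3) by simp
qed

text \<open>Apart from membership in the carrier, every clause is an equation between values of the
  weight, and pointwise operations preserve such equations. This serves both products and
  composition with a linear extension.\<close>

lemma weight_function_combine:
  assumes u: "weight_function M u" and v: "weight_function N v"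
    and f: "\<And>x y. x \<in> carrier M \<Longrightarrow> y \<in> carrier N \<Longrightarrow> f x y \<in> carrier K"
  shows "weight_function K (\<lambda>D c. f (u D c) (v D c))"
proof (rule weight_functionI)
  fix D c assume "is_diagram D" "c \<in> classical D"
  then show "f (u D c) (v D c) \<in> carrier K"
    using f weight_carrier[OF u] weight_carrier[OF v] by blast
next
  fix h D D' c assume *: "isotopic_by h D D'" "c \<in> classical D"
  show "f (u D' (h c)) (v D' (h c)) = f (u D c) (v D c)"
    by (simp only: weight_isotopy[OF u *] weight_isotopy[OF v *])
next
  fix m h D D' c assume *: "move_in m h D D'" "c \<in> classical D - h ` square"
  show "f (u D' c) (v D' c) = f (u D c) (v D c)"
    by (simp only: weight_outside[OF u *] weight_outside[OF v *])
next
  fix h T T' D D' z z'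
  assume *: "(T, T') \<in> pictures RIII" "replaces h T T' D D'" "corresponding T T' z z'"
  show "f (u D' (h z')) (v D' (h z')) = f (u D (h z)) (v D (h z))"
    by (simp only: weight_RIII[OF u *] weight_RIII[OF v *])
next
  fix h D D' assume *: "move_in SV h D D'"
  show "f (u D' (h 0)) (v D' (h 0)) = f (u D (h 0)) (v D (h 0))"
    by (simp only: weight_SV[OF u *] weight_SV[OF v *])
next
  fix D c0 c assume *: "is_diagram D" "c0 \<in> classical D" "c \<in> classical D - {c0}"
  show "f (u (crossing_change c0 D) c) (v (crossing_change c0 D) c) = f (u D c) (v D c)"
    by (simp only: weight_local[OF u *] weight_local[OF v *])
qed

lemma move_in_classical:
  assumes "move_in m h D D'"
  obtains T T' where "(T, T') \<in> pictures m" "replaces h T T' D D'"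
    "classical D \<inter> h ` square = h ` tangle_crossings T"
    "classical D' \<inter> h ` square = h ` tangle_crossings T'"
    "classical D' - h ` square = classical D - h ` square" "inj h"
proof -
  obtain T T' where T: "(T, T') \<in> pictures m" "replaces h T T' D D'"
    using assms unfolding move_in_def by blast
  then obtain a where a: "tangle_at D h a T" "tangle_at D' h a T'" and "plane_isotopy h"
    unfolding replaces_def by blast
  then have h: "inj h" by (simp add: plane_isotopy_inj)
  show thesis
    by (rule that[OF T classical_in_disc[OF a(1) h] classical_in_disc[OF a(2) h]
          replaces_classical[OF T(2) pictures_generic(1)[OF T(1)]] h])
qed

lemma no_virtual_tangle_crossings:
  assumes "(T, T') \<in> pictures m" "m \<in> {VRI, VRII, VRIII}"
  shows "tangle_crossings T = {}" "tangle_crossings T' = {}"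
proof -
  have "snd T = UNIV \<and> snd T' = UNIV"
    using assms by (auto simp: pictures1_def pictures2_def pictures3_def)
  then show "tangle_crossings T = {}" "tangle_crossings T' = {}"
    by (simp_all add: tangle_crossings_def)
qed

lemma pictures1_no_crossing:
  assumes "(T, T') \<in> pictures1 V"
  shows "tangle_crossings T = {}"
proof -
  obtain e k where ek: "e \<in> {1, -1}" "k \<in> {1, -1}"
    "T = ([level (\<lambda>t. Complex t 0) e 0], V)" "T' = ([curl e k], V)"
    using assms unfolding pictures1_def by blast
  have "graph_strand (fst T ! 0) 0" "length (fst T) = 1"
    using graph_strand_level[of e "\<lambda>t. 0" 0] ek(1,3) by simp_all
  then show ?thesis
    using graph_strand_inj[of "fst T ! 0" 0] by (auto simp: tangle_crossings_def)
qed

text \<open>For SV the only possible classical crossing is the origin, which the half turn fixes, so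
  RIII and SV can be treated by one formula.\<close>

lemma weight_pictures3:
  assumes w: "weight_function M w" and T: "(T, T') \<in> pictures m" "replaces h T T' D D'"
    and m: "m \<in> {RIII, SV}" and z: "z \<in> tangle_crossings T"
  shows "w D' (h (- z)) = w D (h z)"
proof (cases "m = RIII")
  case True
  then have "corresponding T T' z (- z)" using T(1) z pictures3_corresponding by simp
  then show ?thesis using weight_RIII[OF w] T True by blast
next
  case False
  then have "m = SV" using m by simp
  then have "snd T = - {0}" using T(1) pictures3_shape(3) by simp
  then have "z = 0" using z unfolding tangle_crossings_def by simp
  moreover have "move_in SV h D D'" using T \<open>m = SV\<close> unfolding move_in_def by blast
  ultimately show ?thesis using weight_SV[OF w] by simp
qed

lemma weight_RII_odd:
  assumes "odd_weight M w" "move_in RII h D D'" "\<alpha> \<in> classical D' \<inter> h ` square"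
    "\<beta> \<in> classical D' \<inter> h ` square" "\<alpha> \<noteq> \<beta>"
  shows "w D' \<beta> = inv\<^bsub>M\<^esub> (w D' \<alpha>)"
proof -
  have "\<forall>h D D'. move_in RII h D D' \<longrightarrow> (\<forall>\<alpha>\<in>classical D' \<inter> h ` square.
      \<forall>\<beta>\<in>classical D' \<inter> h ` square. \<alpha> \<noteq> \<beta> \<longrightarrow> w D' \<beta> = inv\<^bsub>M\<^esub> (w D' \<alpha>))"
    using assms(1) unfolding odd_weight_def by (rule conjunct2)
  from this[THEN spec[where x = h], THEN spec[where x = D], THEN spec[where x = D'],
      THEN mp, THEN bspec, THEN bspec, THEN mp]
  show ?thesis using assms(2-5) .
qed

lemma weight_RII_even:
  assumes "even_weight M w" "move_in RII h D D'" "\<alpha> \<in> classical D' \<inter> h ` square"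
    "\<beta> \<in> classical D' \<inter> h ` square" "\<alpha> \<noteq> \<beta>"
  shows "w D' \<beta> = w D' \<alpha>"
proof -
  have "\<forall>h D D'. move_in RII h D D' \<longrightarrow> (\<forall>\<alpha>\<in>classical D' \<inter> h ` square.
      \<forall>\<beta>\<in>classical D' \<inter> h ` square. \<alpha> \<noteq> \<beta> \<longrightarrow> w D' \<beta> = w D' \<alpha>)"
    using assms(1) unfolding even_weight_def by (rule conjunct2)
  from this[THEN spec[where x = h], THEN spec[where x = D], THEN spec[where x = D'],
      THEN mp, THEN bspec, THEN bspec, THEN mp]
  show ?thesis using assms(2-5) .
qed


section \<open>Invariance of the index functions\<close>

text \<open>Here \<open>p\<close> stands for the product weight. Keeping only its oddness and its
  vanishing at RI crossings lets integer and ring multipliers share one proof.\<close>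

locale index_weights = abelian_group G
  for G :: "('g, 'r) ring_scheme" (structure) and H :: "('h, 'm) monoid_scheme" +
  fixes p :: "'g weight" and w :: "'h weight" and g :: 'h
  assumes odd: "odd_weight (add_monoid G) p"
    and R_set: "is_diagram D \<Longrightarrow> R_set p D \<subseteq> {\<zero>}"
    and even: "even_weight H w"
begin

text \<open>The test \<open>w = g\<close> is moved from the index set into the summand, so that sums
  run over all classical crossings and can be split at the disc of a move.\<close>

definition contribution :: "diagram \<Rightarrow> complex \<Rightarrow> 'g" where
  "contribution D c = (if w D c = g then p D c else \<zero>)"

lemma p_weight: "weight_function (add_monoid G) p"
  using odd unfolding odd_weight_def by blast

lemma w_weight: "weight_function H w"
  using even unfolding even_weight_def by blast

lemma contribution_closed:
  assumes "is_diagram D" "c \<in> classical D"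
  shows "contribution D c \<in> carrier G"
  using weight_carrier[OF p_weight assms] by (simp add: contribution_def)

lemma I_fun_eq_finsum:
  assumes D: "is_diagram D"
  shows "I_fun G D p w g = finsum G (contribution D) (classical D)"
  unfolding I_fun_def
proof (rule add.finprod_mono_neutral_cong_right[symmetric])
  show "finite (classical D)" using finite_classical[OF D] .
  show "contribution D \<in> classical D \<rightarrow> carrier G" using contribution_closed[OF D] by blast
qed (auto simp: contribution_def)

lemma finsum_split:
  assumes D: "is_diagram D"
  shows "finsum G (contribution D) (classical D) =
    finsum G (contribution D) (classical D \<inter> S) \<oplus> finsum G (contribution D) (classical D - S)"
proof -
  have "finsum G (contribution D) ((classical D \<inter> S) \<union> (classical D - S)) =
      finsum G (contribution D) (classical D \<inter> S) \<oplus> finsum G (contribution D) (classical D - S)"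
    using finite_classical[OF D] contribution_closed[OF D] by (intro finsum_Un_disjoint) auto
  then show ?thesis by (simp add: Un_Diff_Int Int_Diff_Un)
qed

section \<open>Sums over the crossings inside the disc of a move\<close>

lemma finsum_in_disc_RI:
  assumes m: "move_in RI h D D'"
  shows "finsum G (contribution D') (classical D' \<inter> h ` square) =
    finsum G (contribution D) (classical D \<inter> h ` square)"
proof -
  have D': "is_diagram D'"
    using m virtual_step_diagrams(2) unfolding virtual_step_def by blast
  obtain T T' where T: "(T, T') \<in> pictures RI"
    "classical D \<inter> h ` square = h ` tangle_crossings T"
    by (rule move_in_classical[OF m])
  then have in_D: "classical D \<inter> h ` square = {}" using pictures1_no_crossing by simp
  have "contribution D' c = \<zero>" if c: "c \<in> classical D' \<inter> h ` square" for c
  proof -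
    \<comment> \<open>The given move itself witnesses that \<open>c\<close> can be removed by
      RI.\<close>
    have "p D' c \<in> R_set p D'" using c m unfolding R_set_def by blast
    then show ?thesis using R_set[OF D'] unfolding contribution_def by auto
  qed
  then have "finsum G (contribution D') (classical D' \<inter> h ` square) = \<zero>"
    by (rule add.finprod_one_eqI)
  then show ?thesis unfolding in_D by simp
qed

lemma finsum_in_disc_RII:
  assumes m: "move_in RII h D D'"
  shows "finsum G (contribution D') (classical D' \<inter> h ` square) =
    finsum G (contribution D) (classical D \<inter> h ` square)"
proof -
  have D': "is_diagram D'"
    using m virtual_step_diagrams(2) unfolding virtual_step_def by blast
  obtain T T' where T: "(T, T') \<in> pictures RII" "inj h"
    "classical D \<inter> h ` square = h ` tangle_crossings T"
    "classical D' \<inter> h ` square = h ` tangle_crossings T'"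
    by (rule move_in_classical[OF m])
  define \<alpha> \<beta> where "\<alpha> = h (Complex (1 / 2) 0)" and "\<beta> = h (Complex (- 1 / 2) 0)"
  have "(T, T') \<in> pictures2 {}" using T(1) by simp
  note crossings = pictures2_crossings[OF this]
  have in_D: "classical D \<inter> h ` square = {}" and in_D': "classical D' \<inter> h ` square = {\<alpha>, \<beta>}"
    unfolding T(3,4) crossings \<alpha>_def \<beta>_def by simp_all
  have ne: "\<alpha> \<noteq> \<beta>" using T(2) unfolding \<alpha>_def \<beta>_def by (simp add: inj_eq)
  have "p D' \<beta> = \<ominus> p D' \<alpha>" "w D' \<beta> = w D' \<alpha>"
    using weight_RII_odd[OF odd m, of \<alpha> \<beta>] weight_RII_even[OF even m, of \<alpha> \<beta>] ne in_D'
    by (simp_all only: a_inv_def insert_iff simp_thms)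
  \<comment> \<open>Evenness of \<open>w\<close> makes \<alpha> and \<beta> pass or fail the test
    \<open>w = g\<close> together; this covers the case that both fail.\<close>
  moreover have "\<ominus> \<zero> = \<zero>" using r_neg[of \<zero>] by simp
  ultimately have "contribution D' \<beta> = \<ominus> contribution D' \<alpha>"
    unfolding contribution_def by (simp only: if_True if_False split: if_split) simp
  moreover have "contribution D' \<alpha> \<in> carrier G"
    using contribution_closed[OF D'] in_D' by blast
  ultimately have "finsum G (contribution D') {\<alpha>, \<beta>} = \<zero>"
    using ne by (simp add: r_neg)
  then show ?thesis unfolding in_D in_D' by simp
qed

text \<open>Both sums are reindexed by the model crossings before the move, through \<open>h\<close>
  on one side and \<open>h\<close> after the half turn on the other; the summands then
  agree.\<close>

lemma finsum_in_disc_RIII_SV: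
  assumes m: "move_in m h D D'" "m \<in> {RIII, SV}"
  shows "finsum G (contribution D') (classical D' \<inter> h ` square) =
    finsum G (contribution D) (classical D \<inter> h ` square)"
proof -
  have D: "is_diagram D" "is_diagram D'"
    using m virtual_step_diagrams unfolding virtual_step_def by blast+
  obtain T T' where T: "(T, T') \<in> pictures m" "replaces h T T' D D'" "inj h"
    "classical D \<inter> h ` square = h ` tangle_crossings T"
    "classical D' \<inter> h ` square = h ` tangle_crossings T'"
    by (rule move_in_classical[OF m(1)])
  let ?X = "tangle_crossings T"
  have "tangle_crossings T' = uminus ` ?X"
  proof (cases "m = RIII")
    case True
    then show ?thesis using T(1) pictures3_crossings[of T T' "{}"] by simp
  next
    case False
    then show ?thesis using m(2) T(1) pictures3_crossings[of T T' "- {0}"] by simp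
  qed
  then have in_D': "classical D' \<inter> h ` square = (\<lambda>z. h (- z)) ` ?X"
    using T(5) by (simp add: image_image)
  have in_carrier: "contribution D \<in> h ` ?X \<rightarrow> carrier G"
    "contribution D' \<in> (\<lambda>z. h (- z)) ` ?X \<rightarrow> carrier G"
    using contribution_closed D T(4) in_D' by blast+
  have eq: "contribution D' (h (- z)) = contribution D (h z)" if "z \<in> ?X" for z
    using weight_pictures3[OF p_weight T(1,2) m(2) that] weight_pictures3[OF w_weight T(1,2) m(2) that]
    by (simp add: contribution_def)
  have inj: "inj_on (\<lambda>z. h (- z)) ?X" "inj_on h ?X"
    using T(3) by (auto intro!: inj_onI dest!: injD)
  have "finsum G (contribution D') ((\<lambda>z. h (- z)) ` ?X) = (\<Oplus>z\<in>?X. contribution D' (h (- z)))"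
    by (rule finsum_reindex[OF in_carrier(2) inj(1)])
  also have "\<dots> = (\<Oplus>z\<in>?X. contribution D (h z))"
    using eq in_carrier(1) by (intro add.finprod_cong') auto
  also have "\<dots> = finsum G (contribution D) (h ` ?X)"
    by (rule finsum_reindex[OF in_carrier(1) inj(2), symmetric])
  finally show ?thesis unfolding in_D' T(4) .
qed

lemma I_fun_move:
  assumes m: "move_in m h D D'"
  shows "I_fun G D p w g = I_fun G D' p w g"
proof -
  have D: "is_diagram D" "is_diagram D'"
    using m virtual_step_diagrams unfolding virtual_step_def by blast+
  obtain T T' where T: "(T, T') \<in> pictures m"
    "classical D \<inter> h ` square = h ` tangle_crossings T"
    "classical D' \<inter> h ` square = h ` tangle_crossings T'"
    and out: "classical D' - h ` square = classical D - h ` square"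
    by (rule move_in_classical[OF m])
  have inside: "finsum G (contribution D') (classical D' \<inter> h ` square) =
      finsum G (contribution D) (classical D \<inter> h ` square)"
  proof (cases "m \<in> {VRI, VRII, VRIII}")
    \<comment> \<open>In a virtual move every point of the model is marked virtual, so both sums are
      empty.\<close>
    case True
    then show ?thesis using no_virtual_tangle_crossings[OF T(1)] T(2,3) by simp
  next
    case False
    then consider "m = RI" | "m = RII" | "m \<in> {RIII, SV}" by (cases m) auto
    then show ?thesis
      using m finsum_in_disc_RI finsum_in_disc_RII finsum_in_disc_RIII_SV by cases blast+
  qed
  have "contribution D' c = contribution D c" if "c \<in> classical D - h ` square" for c
    using weight_outside[OF p_weight m that] weight_outside[OF w_weight m that]
    by (simp add: contribution_def)
  then have "finsum G (contribution D') (classical D' - h ` square) =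
      finsum G (contribution D) (classical D - h ` square)"
    using out contribution_closed[OF D(1)] by (intro add.finprod_cong') auto
  then show ?thesis
    unfolding I_fun_eq_finsum[OF D(1)] I_fun_eq_finsum[OF D(2)]
      finsum_split[OF D(1), of "h ` square"] finsum_split[OF D(2), of "h ` square"] inside by simp
qed

lemma I_fun_isotopic:
  assumes iso: "isotopic_by h D D'"
  shows "I_fun G D p w g = I_fun G D' p w g"
proof -
  have D: "is_diagram D" "is_diagram D'" and h: "inj h"
    using iso plane_isotopy_inj unfolding isotopic_by_def by blast+
  note cl = isotopic_by_classical[OF iso]
  have eq: "contribution D' (h c) = contribution D c" if "c \<in> classical D" for c
    using weight_isotopy[OF p_weight iso that] weight_isotopy[OF w_weight iso that]
    by (simp add: contribution_def)
  have "finsum G (contribution D') (h ` classical D) = (\<Oplus>c\<in>classical D. contribution D' (h c))"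
    using contribution_closed[OF D(2)] cl inj_on_subset[OF h subset_UNIV]
    by (intro finsum_reindex Pi_I) simp_all
  also have "\<dots> = finsum G (contribution D) (classical D)"
    using eq contribution_closed[OF D(1)] by (intro add.finprod_cong') auto
  finally show ?thesis
    unfolding I_fun_eq_finsum[OF D(1)] I_fun_eq_finsum[OF D(2)] cl by simp
qed

lemma I_fun_virtual_step:
  assumes "virtual_step D D'"
  shows "I_fun G D p w g = I_fun G D' p w g"
  using assms I_fun_isotopic I_fun_move unfolding virtual_step_def by blast

lemma I_fun_closed:
  assumes D: "is_diagram D"
  shows "I_fun G D p w g \<in> carrier G"
  unfolding I_fun_eq_finsum[OF D] using contribution_closed[OF D] by (intro finsum_closed) blast

section \<open>The two-sided sum and its behaviour under crossing changes\<close>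

lemma I_flat_eq:
  "I_flat G D p w g = I_fun G D p w g \<oplus> I_fun G (star_diagram D) p w g"
proof -
  have "star_weight p D = p (star_diagram D)" "star_weight w D = w (star_diagram D)"
    by (simp_all add: star_weight_def fun_eq_iff)
  then show ?thesis unfolding I_flat_def I_fun_def by simp
qed

text \<open>A diagram and its star have the same crossing points. Merging the two sums over them
  lets a crossing change be checked summand by summand.\<close>

lemma I_flat_eq_finsum:
  assumes D: "is_diagram D"
  shows "I_flat G D p w g =
    (\<Oplus>c\<in>classical D. contribution D c \<oplus> contribution (star_diagram D) c)"
  unfolding I_flat_eq I_fun_eq_finsum[OF D] I_fun_eq_finsum[OF is_diagram_star[OF D]] classical_star
  using contribution_closed[OF D] contribution_closed[OF is_diagram_star[OF D]]
  by (intro finsum_addf[symmetric]) auto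

lemma I_flat_crossing_change:
  assumes D: "is_diagram D" and c: "c \<in> classical D"
  shows "I_flat G D p w g = I_flat G (crossing_change c D) p w g"
proof -
  let ?D = "crossing_change c D"
  note D' = is_diagram_crossing_change[OF D c]
  note closed = contribution_closed[OF D] contribution_closed[OF is_diagram_star[OF D], simplified]
  have "contribution ?D x \<oplus> contribution (star_diagram ?D) x =
      contribution D x \<oplus> contribution (star_diagram D) x" if x: "x \<in> classical D" for x
  proof (cases "x = c")
    case True
    have "contribution ?D c = contribution (star_diagram D) c"
      "contribution (star_diagram ?D) c = contribution D c"
      using weight_crossing_change(1,2)[OF p_weight D c]
        weight_crossing_change(1,2)[OF w_weight D c]
      by (simp_all add: contribution_def)
    then show ?thesis using True closed[OF c] by (simp add: a_comm)
  next
    case False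
    then show ?thesis
      using weight_crossing_change(3,4)[OF p_weight D c x]
        weight_crossing_change(3,4)[OF w_weight D c x]
      by (simp add: contribution_def)
  qed
  then show ?thesis
    unfolding I_flat_eq_finsum[OF D] I_flat_eq_finsum[OF D'] classical_crossing_change
    using closed by (intro add.finprod_cong'[symmetric]) (auto intro: closed)
qed

lemma I_flat_flat_step:
  assumes "flat_step D D'"
  shows "I_flat G D p w g = I_flat G D' p w g"
  using assms unfolding flat_step_def
proof
  assume step: "virtual_step D D'"
  show ?thesis
    unfolding I_flat_eq I_fun_virtual_step[OF step] I_fun_virtual_step[OF virtual_step_star[OF step]] ..
next
  assume "is_diagram D \<and> (\<exists>c\<in>classical D. D' = crossing_change c D)"
  then show ?thesis using I_flat_crossing_change by blast
qed

lemma equivclp_invariant: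
  assumes "equivclp R x y" "\<And>x y. R x y \<Longrightarrow> f x = f y"
  shows "f x = f y"
  using assms(1)
proof (induction rule: equivclp_induct)
  case base
  show ?case ..
next
  case (step y z)
  then show ?case using assms(2) by auto
qed

lemma virtual_invariant_I_fun: "virtual_invariant G (\<lambda>D. I_fun G D p w g)"
  unfolding virtual_invariant_def
  using I_fun_closed equivclp_invariant[of virtual_step _ _ "\<lambda>D. I_fun G D p w g"]
    I_fun_virtual_step by blast

text \<open>The recursion fixes \<open>A (Suc i)\<close> on diagrams only, so \<open>f\<close> is
  asked to agree with \<open>I_flat\<close> just there; the chain of steps is followed with
  \<open>I_flat\<close> itself.\<close>

lemma flat_invariant_I_flat:
  assumes f: "\<And>D. is_diagram D \<Longrightarrow> f D = I_flat G D p w g"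
  shows "flat_invariant G f"
  unfolding flat_invariant_def
proof (intro conjI allI impI)
  fix D assume D: "is_diagram D"
  show "f D \<in> carrier G"
    unfolding f[OF D] I_flat_eq using D is_diagram_star by (intro a_closed I_fun_closed)
next
  fix D D' assume "is_diagram D \<and> is_diagram D' \<and> equivclp flat_step D D'"
  then show "f D = f D'"
    using f equivclp_invariant[of flat_step D D' "\<lambda>D. I_flat G D p w g"] I_flat_flat_step by simp
qed

end

section \<open>Linear extensions and products of weights\<close>

lemma flat_invariant_closed:
  assumes "flat_invariant G f" "is_diagram D"
  shows "f D \<in> carrier G"
  using assms unfolding flat_invariant_def by blast

text \<open>Flat invariance makes \<open>f\<close> constant on the class, and \<open>D\<close> shows
  that the class is nonempty; this makes \<open>linear_extension\<close> meaningful.\<close>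

lemma the_elem_flat_class:
  assumes f: "flat_invariant G f" and D: "is_diagram D"
  shows "the_elem (f ` flat_class D) = f D"
proof -
  have "D \<in> flat_class D" using D by (simp add: flat_class_def)
  then have "flat_class D \<noteq> {}" by blast
  then show ?thesis
  proof (rule the_elem_image_unique)
    fix D' assume "D' \<in> flat_class D"
    then show "f D' = f D"
      using f D unfolding flat_invariant_def flat_class_def by simp
  qed
qed

lemma keys_VL_flat:
  assumes "x \<in> carrier VL_flat" "K \<in> Poly_Mapping.keys x"
  obtains D where "is_diagram D" "K = flat_class D"
  using assms unfolding VL_flat_def flat_links_def by auto

section \<open>Integer multiples and the linear extension to \<open>VL_flat\<close>\<close>

context abelian_group
begin

lemma add_pow_closed:
  fixes n :: int
  shows "x \<in> carrier G \<Longrightarrow> add_pow G n x \<in> carrier G"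
  using group.int_pow_closed[OF a_group, of x n] by (simp add: add_pow_def)

lemma add_pow_zero: "add_pow G (0 :: int) x = \<zero>"
  by (simp add: add_pow_def)

lemma add_pow_add:
  fixes n m :: int
  assumes "x \<in> carrier G"
  shows "add_pow G (n + m) x = add_pow G n x \<oplus> add_pow G m x"
  using group.int_pow_mult[OF a_group, of x n m] assms by (simp add: add_pow_def)

lemma add_pow_uminus:
  fixes n :: int
  assumes "x \<in> carrier G"
  shows "add_pow G (- n) x = \<ominus> add_pow G n x"
  using group.int_pow_neg[OF a_group, of x n] assms by (simp add: add_pow_def a_inv_def)

lemma the_elem_closed:
  assumes f: "flat_invariant G f" and "x \<in> carrier VL_flat" "K \<in> Poly_Mapping.keys x"
  shows "the_elem (f ` K) \<in> carrier G"
proof -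
  obtain D where "is_diagram D" "K = flat_class D" using keys_VL_flat[OF assms(2,3)] .
  then show ?thesis using the_elem_flat_class[OF f] flat_invariant_closed[OF f] by simp
qed

text \<open>Cancellation can make the keys of \<open>x + y\<close> smaller than the union of the
  keys. Padding with zero coefficients lets all three sums in the proof of additivity run over that
  union.\<close>

lemma linear_extension_superset:
  assumes fin: "finite S" and sub: "Poly_Mapping.keys x \<subseteq> S"
    and closed: "\<And>K. K \<in> S \<Longrightarrow> the_elem (f ` K) \<in> carrier G"
  shows "linear_extension G f x = (\<Oplus>K\<in>S. add_pow G (Poly_Mapping.lookup x K) (the_elem (f ` K)))"
  unfolding linear_extension_def
proof (rule add.finprod_mono_neutral_cong_right[OF fin sub, symmetric])
  show "(\<lambda>K. add_pow G (Poly_Mapping.lookup x K) (the_elem (f ` K))) \<in> S \<rightarrow> carrier G"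
    using closed by (intro Pi_I add_pow_closed)
qed (simp_all add: in_keys_iff add_pow_zero)

lemma linear_extension_closed:
  assumes f: "flat_invariant G f" and x: "x \<in> carrier VL_flat"
  shows "linear_extension G f x \<in> carrier G"
  unfolding linear_extension_def
  using the_elem_closed[OF f x] by (intro finsum_closed Pi_I add_pow_closed)

lemma linear_extension_hom:
  assumes f: "flat_invariant G f"
  shows "linear_extension G f \<in> hom VL_flat (add_monoid G)"
proof (rule homI)
  fix x assume "x \<in> carrier VL_flat"
  then show "linear_extension G f x \<in> carrier (add_monoid G)"
    using linear_extension_closed[OF f] by simp
next
  fix x y assume xy: "x \<in> carrier VL_flat" "y \<in> carrier VL_flat"
  let ?S = "Poly_Mapping.keys x \<union> Poly_Mapping.keys y"
  have S: "finite ?S" "Poly_Mapping.keys x \<subseteq> ?S" "Poly_Mapping.keys y \<subseteq> ?S"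
    "Poly_Mapping.keys (x + y) \<subseteq> ?S"
    using keys_add[of x y] by auto
  have closed: "the_elem (f ` K) \<in> carrier G" if "K \<in> ?S" for K
    using that the_elem_closed[OF f xy(1)] the_elem_closed[OF f xy(2)] by blast
  let ?t = "\<lambda>z K. add_pow G (Poly_Mapping.lookup z K) (the_elem (f ` K))"
  have t: "?t z \<in> ?S \<rightarrow> carrier G" for z :: "flat_link \<Rightarrow>\<^sub>0 int"
    using closed by (intro Pi_I add_pow_closed)
  have "linear_extension G f (x + y) = (\<Oplus>K\<in>?S. ?t (x + y) K)"
    by (rule linear_extension_superset[OF S(1,4) closed])
  also have "\<dots> = (\<Oplus>K\<in>?S. ?t x K \<oplus> ?t y K)"
  proof (rule add.finprod_cong')
    show "(\<lambda>K. ?t x K \<oplus> ?t y K) \<in> ?S \<rightarrow> carrier G"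
      using closed by (intro Pi_I a_closed add_pow_closed)
  qed (simp_all only: lookup_add add_pow_add[OF closed])
  also have "\<dots> = (\<Oplus>K\<in>?S. ?t x K) \<oplus> (\<Oplus>K\<in>?S. ?t y K)"
    by (rule finsum_addf[OF t t])
  also have "\<dots> = linear_extension G f x \<oplus> linear_extension G f y"
    by (simp only: linear_extension_superset[OF S(1,2) closed] linear_extension_superset[OF S(1,3) closed])
  finally show "linear_extension G f (x \<otimes>\<^bsub>VL_flat\<^esub> y) =
      linear_extension G f x \<otimes>\<^bsub>add_monoid G\<^esub> linear_extension G f y"
    by (simp add: VL_flat_def)
qed

lemma linear_extension_frag_of:
  assumes f: "flat_invariant G f" and D: "is_diagram D"
  shows "linear_extension G f (frag_of (flat_class D)) = f D"
proof -
  have fD: "f D \<in> carrier G" using flat_invariant_closed[OF f D] .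
  have one: "add_pow G (1 :: int) (f D) = f D"
    using group.int_pow_1[OF a_group, of "f D"] fD by (simp add: add_pow_def)
  show ?thesis
    unfolding linear_extension_def
    using fD by (simp add: the_elem_flat_class[OF f D] one)
qed

text \<open>The composite depends only on the value of \<open>F\<close>, so equalities of weights
  carry over; flat invariance of \<open>f\<close> is what puts the values into
  \<open>G\<close>.\<close>

lemma even_weight_compose:
  assumes f: "flat_invariant G f" and F: "even_weight VL_flat F"
  shows "even_weight (add_monoid G) (compose_weight G f F)"
  unfolding even_weight_def
proof (intro conjI allI impI ballI)
  have Fw: "weight_function VL_flat F" using F unfolding even_weight_def by (rule conjunct1)
  show "weight_function (add_monoid G) (compose_weight G f F)"
    unfolding compose_weight_def
    \<comment> \<open>Composition is obtained as a combination of \<open>F\<close> with itself that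
      reads the first argument.\<close>
    by (rule weight_function_combine[OF Fw Fw, of "\<lambda>x y. linear_extension G f x"])
      (simp add: linear_extension_closed[OF f])
next
  fix h D D' \<alpha> \<beta>
  assume "move_in RII h D D'" "\<alpha> \<in> classical D' \<inter> h ` square" "\<beta> \<in> classical D' \<inter> h ` square"
    "\<alpha> \<noteq> \<beta>"
  then show "compose_weight G f F D' \<beta> = compose_weight G f F D' \<alpha>"
    unfolding compose_weight_def by (simp only: weight_RII_even[OF F])
qed

text \<open>\<open>f\<close> abstracts both the integer multiple and the ring product. At an RII
  pair the second factors agree and the first are inverse, so the sign rule \<open>inv\<close>
  yields oddness.\<close>

lemma odd_weight_combine:
  assumes u: "odd_weight M u" and v: "even_weight (add_monoid G) v"
    and closed: "\<And>a x. a \<in> carrier M \<Longrightarrow> x \<in> carrier G \<Longrightarrow> f a x \<in> carrier G"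
    and inv: "\<And>a x. a \<in> carrier M \<Longrightarrow> x \<in> carrier G \<Longrightarrow> f (inv\<^bsub>M\<^esub> a) x = \<ominus> f a x"
  shows "odd_weight (add_monoid G) (\<lambda>D c. f (u D c) (v D c))"
proof -
  have uw: "weight_function M u"
    using u unfolding odd_weight_def by (rule conjunct1)
  have vw: "weight_function (add_monoid G) v"
    using v unfolding even_weight_def by (rule conjunct1)
  have "weight_function (add_monoid G) (\<lambda>D c. f (u D c) (v D c))"
    by (rule weight_function_combine[OF uw vw]) (simp add: closed)
  moreover have "f (u D' \<beta>) (v D' \<beta>) = inv\<^bsub>add_monoid G\<^esub> f (u D' \<alpha>) (v D' \<alpha>)"
    if m: "move_in RII h D D'" and \<alpha>: "\<alpha> \<in> classical D' \<inter> h ` square"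
      and \<beta>: "\<beta> \<in> classical D' \<inter> h ` square" and ne: "\<alpha> \<noteq> \<beta>" for h D D' \<alpha> \<beta>
  proof -
    have "is_diagram D'" using m virtual_step_diagrams(2) unfolding virtual_step_def by blast
    then have "u D' \<alpha> \<in> carrier M" "v D' \<alpha> \<in> carrier G"
      using weight_carrier[OF uw, of D' \<alpha>] weight_carrier[OF vw, of D' \<alpha>] \<alpha> by simp_all
    then show ?thesis
      unfolding weight_RII_odd[OF u m \<alpha> \<beta> ne] weight_RII_even[OF v m \<alpha> \<beta> ne]
      by (simp only: inv a_inv_def)
  qed
  ultimately show ?thesis
    unfolding odd_weight_def by (intro conjI allI impI ballI)
qed

end

text \<open>The absorbing law is asked only for values of \<open>v\<close> at classical crossings,
  since in a ring zero times \<open>x\<close> is known to vanish only for \<open>x\<close> in the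
  carrier.\<close>

lemma R_set_combine:
  assumes "R_set u D \<subseteq> {a}" "\<And>x. x \<in> v D ` classical D \<Longrightarrow> f a x = b"
  shows "R_set (\<lambda>D c. f (u D c) (v D c)) D \<subseteq> {b}"
proof
  fix y assume "y \<in> R_set (\<lambda>D c. f (u D c) (v D c)) D"
  then obtain c h D' where c: "y = f (u D c) (v D c)" "c \<in> classical D"
    "move_in RI h D' D" "c \<in> h ` square"
    unfolding R_set_def by blast
  then have "u D c \<in> R_set u D" unfolding R_set_def by blast
  then have "u D c = a" using assms(1) by blast
  then show "y \<in> {b}" using assms(2) c(1,2) by simp
qed

lemma index_weights_product:
  assumes G: "abelian_group G" and u: "odd_multiplier G u"
    and v: "even_weight (add_monoid G) v" and w: "even_weight H w"
  shows "index_weights G H (weight_product G u v) w"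
proof -
  interpret abelian_group G by (rule G)
  have vw: "weight_function (add_monoid G) v"
    using v unfolding even_weight_def by (rule conjunct1)
  then have vD: "x \<in> carrier G" if "is_diagram D" "x \<in> v D ` classical D" for D x
    using weight_carrier[OF vw] that by auto
  show ?thesis
  proof (cases u)
    case (Int_Valued u')
    have odd: "odd_weight integer_group u'" and R: "\<And>D. is_diagram D \<Longrightarrow> R_set u' D \<subseteq> {0}"
      using u Int_Valued by simp_all
    have "odd_weight (add_monoid G) (\<lambda>D c. add_pow G (u' D c) (v D c))"
      by (rule odd_weight_combine[OF odd v]) (simp_all add: add_pow_closed add_pow_uminus)
    moreover have "R_set (\<lambda>D c. add_pow G (u' D c) (v D c)) D \<subseteq> {\<zero>\<^bsub>G\<^esub>}" if "is_diagram D" for D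
      by (rule R_set_combine[OF R[OF that]]) (rule add_pow_zero)
    ultimately show ?thesis
      unfolding Int_Valued weight_product.simps by (unfold_locales) (use w in simp_all)
  next
    case (Ring_Valued u')
    have odd: "odd_weight (add_monoid G) u'" and R: "\<And>D. is_diagram D \<Longrightarrow> R_set u' D \<subseteq> {\<zero>\<^bsub>G\<^esub>}"
      and ring: "ring G"
      using u Ring_Valued by simp_all
    interpret ring G by (rule ring)
    have "odd_weight (add_monoid G) (\<lambda>D c. u' D c \<otimes>\<^bsub>G\<^esub> v D c)"
    proof (rule odd_weight_combine[OF odd v])
      fix a x assume ax: "a \<in> carrier (add_monoid G)" "x \<in> carrier G"
      then show "a \<otimes>\<^bsub>G\<^esub> x \<in> carrier G" by simp
      show "(inv\<^bsub>add_monoid G\<^esub> a) \<otimes>\<^bsub>G\<^esub> x = \<ominus>\<^bsub>G\<^esub> (a \<otimes>\<^bsub>G\<^esub> x)"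
        using l_minus[of a x] ax unfolding a_inv_def by simp
    qed
    moreover have "R_set (\<lambda>D c. u' D c \<otimes>\<^bsub>G\<^esub> v D c) D \<subseteq> {\<zero>\<^bsub>G\<^esub>}" if D: "is_diagram D" for D
      by (rule R_set_combine[OF R[OF D]]) (rule l_null[OF vD[OF D]])
    ultimately show ?thesis
      unfolding Ring_Valued weight_product.simps by (unfold_locales) (use w in simp_all)
  qed
qed

theorem proposition1:
  fixes G :: "('g, 'r) ring_scheme"
    and H :: "nat \<Rightarrow> ('h, 'm) monoid_scheme"
    and A :: "nat \<Rightarrow> diagram \<Rightarrow> 'g"
    and F :: "nat \<Rightarrow> (flat_link \<Rightarrow>\<^sub>0 int) weight"
    and w :: "nat \<Rightarrow> 'h weight"
    and h :: "nat \<Rightarrow> 'h"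
    and u :: "nat \<Rightarrow> 'g multiplier"
  assumes "abelian_group G"
    and "flat_invariant G (A 1)"
    and "\<And>i. i \<ge> 1 \<Longrightarrow> even_weight VL_flat (F i)"
    and "\<And>i. i \<ge> 1 \<Longrightarrow> comm_group (H i)"
    and "\<And>i. i \<ge> 1 \<Longrightarrow> even_weight (H i) (w i)"
    and "\<And>i. i \<ge> 1 \<Longrightarrow> h i \<in> carrier (H i)"
    and "\<And>i. i \<ge> 1 \<Longrightarrow> odd_multiplier G (u i)"
    and "\<And>i D. i \<ge> 1 \<Longrightarrow> is_diagram D \<Longrightarrow>
           A (Suc i) D =
             I_flat G D (weight_product G (u i) (compose_weight G (A i) (F i))) (w i) (h i)"
  shows "\<forall>i\<ge>1.
           even_weight (add_monoid G) (compose_weight G (A i) (F i)) \<and>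
           virtual_invariant G
             (\<lambda>D. I_fun G D (weight_product G (u i) (compose_weight G (A i) (F i))) (w i) (h i)) \<and>
           flat_invariant G (A (Suc i)) \<and>
           linear_extension G (A (Suc i)) \<in> hom VL_flat (add_monoid G) \<and>
           (\<forall>D. is_diagram D \<longrightarrow>
              linear_extension G (A (Suc i)) (frag_of (flat_class D)) = A (Suc i) D)"
proof -
  interpret abelian_group G by (rule assms(1))
  have recursion: "even_weight (add_monoid G) (compose_weight G (A i) (F i)) \<and>
      virtual_invariant G
        (\<lambda>D. I_fun G D (weight_product G (u i) (compose_weight G (A i) (F i))) (w i) (h i)) \<and>
      flat_invariant G (A (Suc i))"
    if i: "i \<ge> 1" and Ai: "flat_invariant G (A i)" for i
  proof -
    have composite: "even_weight (add_monoid G) (compose_weight G (A i) (F i))"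
      using even_weight_compose[OF Ai assms(3)[OF i]] .
    interpret index_weights G "H i" "weight_product G (u i) (compose_weight G (A i) (F i))" "w i" "h i"
      by (rule index_weights_product[OF assms(1) assms(7)[OF i] composite assms(5)[OF i]])
    have "flat_invariant G (A (Suc i))"
      by (rule flat_invariant_I_flat) (rule assms(8)[OF i])
    with composite virtual_invariant_I_fun show ?thesis by (intro conjI)
  qed
  \<comment> \<open>Flat invariance is the only statement carried through the induction; the
    remaining claims at stage \<open>i\<close> follow from it by \<open>recursion\<close>.\<close>
  have flat: "flat_invariant G (A i)" if "i \<ge> 1" for i
    using that
  proof (induction i rule: dec_induct)
    case base
    show ?case using assms(2) .
  next
    case (step i)
    then show ?case using recursion by blast
  qed
  show ?thesis
  proof (intro allI impI)
    fix i :: nat assume i: "i \<ge> 1"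
    have flat': "flat_invariant G (A (Suc i))" using flat[of "Suc i"] by simp
    show "even_weight (add_monoid G) (compose_weight G (A i) (F i)) \<and>
      virtual_invariant G
        (\<lambda>D. I_fun G D (weight_product G (u i) (compose_weight G (A i) (F i))) (w i) (h i)) \<and>
      flat_invariant G (A (Suc i)) \<and>
      linear_extension G (A (Suc i)) \<in> hom VL_flat (add_monoid G) \<and>
      (\<forall>D. is_diagram D \<longrightarrow>
         linear_extension G (A (Suc i)) (frag_of (flat_class D)) = A (Suc i) D)"
      using recursion[OF i flat[OF i]] linear_extension_hom[OF flat'] linear_extension_frag_of[OF flat']
      by blast
  qed
qed

end
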